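(* Let $K$ be a field and let $n \ge 3$ be an integer. Let $\mathrm{Graph}_{\dim,\mathrm{depth}}(n)$ be the set of all pairs $(d,p) \in \mathbb{N}^2$ for which there is a finite simple undirected connected graph $G$ on $n$ vertices with $\dim G = d$ and $\operatorname{depth} G = p$. Then $$\mathrm{Graph}_{\dim,\mathrm{depth}}(n) = C^{*}(n),$$ where $$C^{*}(n) = \{(d,p) \in \mathbb{N}^2 \mid 1 \le p \le d \le n-1,\ d \le (n-d)(d-p+1)\}.$$
   Context: For a graph $G$ on the vertex set $\{1,\dots,n\}$ with edge set $E(G)$, let $R = K[x_1,\dots,x_n]$ be the standard graded polynomial ring over the field $K$. The edge ideal of $G$ is $I(G) = (x_i x_j : \{i,j\} \in E(G)) \subset R$. Write $\dim G$ and $\operatorname{depth} G$ for the Krull dimension and the depth of $R/I(G)$, respectively. *)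

theory Defs
  imports
    "HOL-Library.Poly_Mapping"
    "HOL-Library.Extended_Nat"
    "HOL-Library.Ramsey"
    "HOL-Algebra.QuotRing"
    "HOL-Algebra.Module"
begin

section \<open>Krull dimension and depth\<close>

text \<open>
  The supremum of the lengths of chains of primes \<open>P 0 \<subset> \<dots> \<subset> P m\<close>; such a chain has length \<open>m\<close>.
\<close>
definition krull_dim :: "('a, 'b) ring_scheme \<Rightarrow> enat" where
  "krull_dim A = Sup {enat m | m. \<exists>P :: nat \<Rightarrow> 'a set.
     (\<forall>i\<le>m. primeideal (P i) A) \<and> (\<forall>i<m. P i \<subset> P (Suc i))}"

text \<open>The submodule \<open>J M\<close> of \<open>M\<close>.\<close>
definition ideal_smult ::
  "('a, 'r) ring_scheme \<Rightarrow> 'a set \<Rightarrow> ('a, 'c, 'm) module_scheme \<Rightarrow> 'c set" where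
  "ideal_smult R J M =
     \<Inter>{N. submodule N R M \<and> {a \<odot>\<^bsub>M\<^esub> x | a x. a \<in> J \<and> x \<in> carrier M} \<subseteq> N}"

text \<open>
  \<open>f\<^sub>0, \<dots>, f\<^sub>r\<^sub>-\<^sub>1\<close> is \<open>M\<close>-regular if \<open>f\<^sub>i\<close> is a nonzerodivisor on
  \<open>M / (f\<^sub>0, \<dots>, f\<^sub>i\<^sub>-\<^sub>1) M\<close> for every \<open>i < r\<close>, and \<open>M \<noteq> (f\<^sub>0, \<dots>, f\<^sub>r\<^sub>-\<^sub>1) M\<close>.  The first condition
  is phrased with representatives in \<open>M\<close>.
\<close>
definition regular_sequence ::
  "('a, 'r) ring_scheme \<Rightarrow> ('a, 'c, 'm) module_scheme \<Rightarrow> 'a list \<Rightarrow> bool" where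
  "regular_sequence R M fs \<longleftrightarrow>
     set fs \<subseteq> carrier R \<and>
     (\<forall>i<length fs. \<forall>x\<in>carrier M.
        (fs ! i) \<odot>\<^bsub>M\<^esub> x \<in> ideal_smult R (Idl\<^bsub>R\<^esub> (set (take i fs))) M \<longrightarrow>
        x \<in> ideal_smult R (Idl\<^bsub>R\<^esub> (set (take i fs))) M) \<and>
     ideal_smult R (Idl\<^bsub>R\<^esub> (set fs)) M \<noteq> carrier M"

text \<open>
  For \<open>J\<close> the (graded) maximal ideal of a local (standard graded) Noetherian ring \<open>R\<close>, and \<open>M\<close>
  finitely generated (and graded), this is the usual depth of \<open>M\<close>.
\<close>
definition module_depth ::
  "('a, 'r) ring_scheme \<Rightarrow> 'a set \<Rightarrow> ('a, 'c, 'm) module_scheme \<Rightarrow> enat" where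
  "module_depth R J M = Sup {enat (length fs) | fs. set fs \<subseteq> J \<and> regular_sequence R M fs}"

definition quotient_module :: "('a, 'r) ring_scheme \<Rightarrow> 'a set \<Rightarrow> ('a, 'a set) module" where
  "quotient_module R I =
     ring.extend (R Quot I) (module.fields (\<lambda>a X. (I +>\<^bsub>R\<^esub> a) \<otimes>\<^bsub>R Quot I\<^esub> X))"


section \<open>Polynomial rings and edge ideals\<close>

text \<open>
  An element of \<^typ>\<open>(nat \<Rightarrow>\<^sub>0 nat) \<Rightarrow>\<^sub>0 'k\<close> is a polynomial in variables indexed by \<^typ>\<open>nat\<close>:
  its keys are the exponent vectors of its monomials, and the product is convolution.
  The ring \<open>K[x\<^sub>1, \<dots>, x\<^sub>n]\<close> consists of those polynomials in which only \<open>x\<^sub>1, \<dots>, x\<^sub>n\<close> occur.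
\<close>
type_synonym 'k mpoly = "(nat \<Rightarrow>\<^sub>0 nat) \<Rightarrow>\<^sub>0 'k"

definition mpoly_ring :: "nat \<Rightarrow> 'k::field mpoly ring" where
  "mpoly_ring n =
     \<lparr>carrier = {f. \<forall>m\<in>Poly_Mapping.keys f. Poly_Mapping.keys m \<subseteq> {1..n}}, mult = (*), one = 1, zero = 0, add = (+)\<rparr>"

definition mvar :: "nat \<Rightarrow> 'k::field mpoly" where
  "mvar i = Poly_Mapping.single (Poly_Mapping.single i 1) 1"

definition irrelevant_ideal :: "nat \<Rightarrow> 'k::field mpoly set" where
  "irrelevant_ideal n = Idl\<^bsub>mpoly_ring n\<^esub> (mvar ` {1..n})"

text \<open>A graph on the vertex set \<open>{1..n}\<close> is represented by its set of edges.\<close>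

definition simple_graph :: "nat \<Rightarrow> nat set set \<Rightarrow> bool" where
  "simple_graph n E \<longleftrightarrow> E \<subseteq> [{1..n}]\<^bsup>2\<^esup>"

definition connected_graph :: "nat \<Rightarrow> nat set set \<Rightarrow> bool" where
  "connected_graph n E \<longleftrightarrow> (\<forall>u\<in>{1..n}. \<forall>v\<in>{1..n}. (u, v) \<in> {(a, b). {a, b} \<in> E}\<^sup>*)"

definition edge_ideal :: "nat \<Rightarrow> nat set set \<Rightarrow> 'k::field mpoly set" where
  "edge_ideal n E = Idl\<^bsub>mpoly_ring n\<^esub> {mvar i * mvar j | i j. {i, j} \<in> E}"

definition graph_dim :: "'k::field itself \<Rightarrow> nat \<Rightarrow> nat set set \<Rightarrow> enat" where
  "graph_dim K n E = krull_dim (mpoly_ring n Quot (edge_ideal n E :: 'k mpoly set))"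

definition graph_depth :: "'k::field itself \<Rightarrow> nat \<Rightarrow> nat set set \<Rightarrow> enat" where
  "graph_depth K n E =
     module_depth (mpoly_ring n) (irrelevant_ideal n)
       (quotient_module (mpoly_ring n) (edge_ideal n E :: 'k mpoly set))"

definition Graph_dim_depth :: "'k::field itself \<Rightarrow> nat \<Rightarrow> (nat \<times> nat) set" where
  "Graph_dim_depth K n = {(d, p). \<exists>E. simple_graph n E \<and> connected_graph n E \<and>
     graph_dim K n E = enat d \<and> graph_depth K n E = enat p}"

text \<open>The truncated subtractions agree with the integer ones: \<open>p \<le> d < n\<close> if \<open>1 \<le> p \<le> d \<le> n - 1\<close>.\<close>
definition C_star :: "nat \<Rightarrow> (nat \<times> nat) set" where
  "C_star n = {(d, p). 1 \<le> p \<and> p \<le> d \<and> d \<le> n - 1 \<and> d \<le> (n - d) * (d - p + 1)}"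

end

(*
  Let d be the independence number and p the depth.  The dimension is d because a prime containing
  I(G) contains all variables outside some independent set A, and more than |A| elements of K[A]
  are algebraically dependent; the lowest terms of a dependence relation bound the length of a
  chain of primes, and, multiplied by the product of the variables of a maximal independent set A,
  the length of a regular sequence (pass to powers of its members, so that this product avoids the
  ideal they generate).  Hence p <= |A|, and it remains to find a small maximal independent set:
  its vertices outside a maximum independent set S are chosen greedily around a vertex where a
  submodular excess function is at least its average.

  Conversely, take a clique on n - d vertices, each joined to a window of e = d - p + 1 out of d
  independent vertices.  The linear forms x_s - x_t with s = t mod e and, at the end,
  x_1 + (sum of the clique variables) form a regular sequence of length p: modulo the first i of
  them, I(G) is an intersection of kernels of substitutions, hence of primes.
*)
theory Submission
  imports Defs
begin

section \<open>Ideals and regular sequences in a subring\<close>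

text \<open>The inequality comes from counting neighbourhoods: the n - d vertices outside S dominate
  S, so some c has at least d/(n-d) neighbours in S, and trading these for c gives an independent
  set of the right size. It need not be maximal: other vertices outside S may have become free, and
  each of them enlarges it. So c is completed to an independent T outside S that admits no further
  such vertex, and T with its non-neighbours in S has size d - h(T), where h(T) = |N(T)| - |T| is
  the excess. As h is not monotone and may be negative, a good value at c alone does not control
  h(T). Contracting a set U of least excess makes h nonnegative, hence subadditive, and since S is
  maximum, the part of T inside U does no harm.

  In the construction, c and the leaves outside its window form a maximal independent set of d - e +
  1 = p vertices, and d <= (n-d) e says that n - d windows of length e can cover d leaves. A window
  of consecutive leaves meets each residue class modulo e once, so identifying congruent leaves
  never merges two neighbours of one clique vertex.\<close>

fun list_monomial :: "'a::comm_ring_1 list \<Rightarrow> nat list \<Rightarrow> 'a" where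
  "list_monomial (f # fs) (k # ks) = f ^ k * list_monomial fs ks"
| "list_monomial _ _ = 1"

text \<open>Subrings of a type-class ring: the operations remain those of the type, so its algebraic
  simplification applies, and the polynomial ring in n variables becomes a subset of the polynomials
  in all variables.\<close>

locale comm_subring =
  fixes R :: "'a::comm_ring_1 set"
  assumes one_closed: "1 \<in> R"
    and add_closed: "a \<in> R \<Longrightarrow> b \<in> R \<Longrightarrow> a + b \<in> R"
    and mult_closed: "a \<in> R \<Longrightarrow> b \<in> R \<Longrightarrow> a * b \<in> R"
    and uminus_closed: "a \<in> R \<Longrightarrow> - a \<in> R"
begin

lemma zero_closed: "0 \<in> R"
  using add_closed[OF one_closed uminus_closed[OF one_closed]] by simp

lemma diff_closed: "a \<in> R \<Longrightarrow> b \<in> R \<Longrightarrow> a - b \<in> R"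
  using add_closed[of a "- b"] uminus_closed by simp

lemma power_closed: "a \<in> R \<Longrightarrow> a ^ k \<in> R"
  by (induction k) (auto intro: one_closed mult_closed)

lemma sum_closed: "(\<And>x. x \<in> A \<Longrightarrow> f x \<in> R) \<Longrightarrow> sum f A \<in> R"
  by (induction A rule: infinite_finite_induct) (auto intro: zero_closed add_closed)

lemma prod_closed: "(\<And>x. x \<in> A \<Longrightarrow> f x \<in> R) \<Longrightarrow> prod f A \<in> R"
  by (induction A rule: infinite_finite_induct) (auto intro: one_closed mult_closed)

definition is_ideal :: "'a set \<Rightarrow> bool" where
  "is_ideal J \<longleftrightarrow> J \<subseteq> R \<and> 0 \<in> J \<and> (\<forall>a\<in>J. \<forall>b\<in>J. a + b \<in> J) \<and> (\<forall>r\<in>R. \<forall>a\<in>J. r * a \<in> J)"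

lemma is_idealI:
  assumes "J \<subseteq> R" "0 \<in> J" "\<And>a b. a \<in> J \<Longrightarrow> b \<in> J \<Longrightarrow> a + b \<in> J"
    "\<And>r a. r \<in> R \<Longrightarrow> a \<in> J \<Longrightarrow> r * a \<in> J"
  shows "is_ideal J"
  using assms unfolding is_ideal_def by blast

lemma ideal_sub: "is_ideal J \<Longrightarrow> a \<in> J \<Longrightarrow> a \<in> R"
  unfolding is_ideal_def by blast

lemma ideal_zero: "is_ideal J \<Longrightarrow> 0 \<in> J"
  unfolding is_ideal_def by blast

lemma ideal_add: "is_ideal J \<Longrightarrow> a \<in> J \<Longrightarrow> b \<in> J \<Longrightarrow> a + b \<in> J"
  unfolding is_ideal_def by blast

lemma ideal_mult: "is_ideal J \<Longrightarrow> r \<in> R \<Longrightarrow> a \<in> J \<Longrightarrow> r * a \<in> J"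
  unfolding is_ideal_def by blast

lemma ideal_mult_right: "is_ideal J \<Longrightarrow> r \<in> R \<Longrightarrow> a \<in> J \<Longrightarrow> a * r \<in> J"
  using ideal_mult[of J r a] by (simp add: mult.commute)

lemma ideal_uminus: "is_ideal J \<Longrightarrow> a \<in> J \<Longrightarrow> - a \<in> J"
  using ideal_mult[of J "- 1" a] uminus_closed[OF one_closed] by simp

lemma ideal_diff: "is_ideal J \<Longrightarrow> a \<in> J \<Longrightarrow> b \<in> J \<Longrightarrow> a - b \<in> J"
  using ideal_add[of J a "- b"] ideal_uminus[of J b] by simp

lemma ideal_sum: "is_ideal J \<Longrightarrow> (\<And>x. x \<in> A \<Longrightarrow> f x \<in> J) \<Longrightarrow> sum f A \<in> J"
  by (induction A rule: infinite_finite_induct) (auto intro: ideal_zero ideal_add)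

lemma ideal_cong: "is_ideal J \<Longrightarrow> a - b \<in> J \<Longrightarrow> a \<in> J \<longleftrightarrow> b \<in> J"
  using ideal_diff[of J a "a - b"] ideal_add[of J "a - b" b] by auto

lemma ideal_prod_cong:
  assumes J: "is_ideal J"
    and "\<And>x. x \<in> A \<Longrightarrow> f x \<in> R \<and> g x \<in> R \<and> f x - g x \<in> J"
  shows "prod f A - prod g A \<in> J"
  using assms(2)
proof (induction A rule: infinite_finite_induct)
  case (insert x A)
  have "prod f (insert x A) - prod g (insert x A) =
      f x * (prod f A - prod g A) + prod g A * (f x - g x)"
    using insert.hyps by (simp add: algebra_simps)
  also have "\<dots> \<in> J"
    using insert.prems insert.IH by (intro ideal_add[OF J] ideal_mult[OF J] prod_closed) auto
  finally show ?case .
qed (use ideal_zero[OF J] in auto)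

lemma ideal_power_cong:
  assumes "is_ideal J" "a \<in> R" "b \<in> R" "a - b \<in> J"
  shows "a ^ k - b ^ k \<in> J"
  using ideal_prod_cong[of J "{..<k}" "\<lambda>_. a" "\<lambda>_. b"] assms by simp

lemma ideal_colon:
  assumes J: "is_ideal J" and y: "y \<in> R"
  shows "is_ideal {g \<in> R. y * g \<in> J}"
proof (rule is_idealI)
  fix r a assume "r \<in> R" "a \<in> {g \<in> R. y * g \<in> J}"
  then show "r * a \<in> {g \<in> R. y * g \<in> J}"
    using ideal_mult[OF J, of r "y * a"] by (auto intro: mult_closed simp: mult.left_commute)
qed (use J in \<open>auto simp: distrib_left intro: zero_closed add_closed ideal_zero ideal_add\<close>)

section \<open>Nonzerodivisors modulo an ideal, and adjoining one element\<close>

definition nzd :: "'a \<Rightarrow> 'a set \<Rightarrow> bool" where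
  "nzd f J \<longleftrightarrow> (\<forall>x\<in>R. f * x \<in> J \<longrightarrow> x \<in> J)"

lemma nzdD: "nzd f J \<Longrightarrow> x \<in> R \<Longrightarrow> f * x \<in> J \<Longrightarrow> x \<in> J"
  unfolding nzd_def by blast

lemma nzd_power: "nzd f J \<Longrightarrow> f \<in> R \<Longrightarrow> x \<in> R \<Longrightarrow> f ^ k * x \<in> J \<Longrightarrow> x \<in> J"
proof (induction k)
  case (Suc k)
  have "f * (f ^ k * x) \<in> J" using Suc.prems(4) by (simp add: mult.assoc)
  then have "f ^ k * x \<in> J"
    using nzdD[OF Suc.prems(1)] Suc.prems by (auto intro: mult_closed power_closed)
  then show ?case using Suc by blast
qed simp

text \<open>This is the ideal J + f R, in explicit form because the exchange arguments below read
  off the two summands of its elements.\<close>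

definition extend :: "'a set \<Rightarrow> 'a \<Rightarrow> 'a set" where
  "extend J f = {a + f * b | a b. a \<in> J \<and> b \<in> R}"

lemma extendE: "x \<in> extend J f \<Longrightarrow> (\<And>a b. a \<in> J \<Longrightarrow> b \<in> R \<Longrightarrow> x = a + f * b \<Longrightarrow> P) \<Longrightarrow> P"
  unfolding extend_def by blast

lemma extendI: "a \<in> J \<Longrightarrow> b \<in> R \<Longrightarrow> a + f * b \<in> extend J f"
  unfolding extend_def by blast

lemma extend_subset: "J \<subseteq> extend J f"
  using extendI[of _ J 0 f] zero_closed by fastforce

lemma extend_generator: "is_ideal J \<Longrightarrow> f \<in> extend J f"
  using extendI[of 0 J 1 f] ideal_zero one_closed by simp

lemma extend_ideal:
  assumes J: "is_ideal J" and f: "f \<in> R"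
  shows "is_ideal (extend J f)"
proof (rule is_idealI)
  show "extend J f \<subseteq> R"
    unfolding extend_def by (auto intro!: add_closed mult_closed f dest: ideal_sub[OF J])
  show "0 \<in> extend J f" using extend_subset ideal_zero[OF J] by blast
next
  fix a b assume "a \<in> extend J f" "b \<in> extend J f"
  then obtain a1 a2 b1 b2 where "a1 \<in> J" "a2 \<in> R" "b1 \<in> J" "b2 \<in> R"
    "a = a1 + f * a2" "b = b1 + f * b2" by (elim extendE) blast
  then show "a + b \<in> extend J f"
    using extendI[of "a1 + b1" J "a2 + b2" f] ideal_add[OF J] add_closed
    by (simp add: algebra_simps)
next
  fix r a assume "r \<in> R" "a \<in> extend J f"
  then obtain a1 a2 where "r \<in> R" "a1 \<in> J" "a2 \<in> R" "a = a1 + f * a2" by (elim extendE) blast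
  then show "r * a \<in> extend J f"
    using extendI[OF ideal_mult[OF J, of r a1] mult_closed[of r a2], of f]
    by (simp add: distrib_left mult.left_commute)
qed

lemma extend_least:
  assumes "is_ideal K" "J \<subseteq> K" "f \<in> K"
  shows "extend J f \<subseteq> K"
  using assms by (auto elim!: extendE intro!: ideal_add ideal_mult_right)

lemma foldl_extend_ideal:
  "is_ideal J \<Longrightarrow> set fs \<subseteq> R \<Longrightarrow> is_ideal (foldl extend J fs)"
  by (induction fs arbitrary: J) (auto intro: extend_ideal)

lemma foldl_extend_subset: "J \<subseteq> foldl extend J fs"
  by (induction fs arbitrary: J) (use extend_subset in fastforce)+

lemma foldl_extend_generators:
  "is_ideal J \<Longrightarrow> set fs \<subseteq> R \<Longrightarrow> set fs \<subseteq> foldl extend J fs"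
proof (induction fs arbitrary: J)
  case (Cons f fs)
  then show ?case
    using extend_generator[of J f] foldl_extend_subset[of "extend J f" fs] extend_ideal[of J f] by auto
qed simp

lemma foldl_extend_least:
  "is_ideal K \<Longrightarrow> J \<subseteq> K \<Longrightarrow> set fs \<subseteq> K \<Longrightarrow> foldl extend J fs \<subseteq> K"
proof (induction fs arbitrary: J)
  case (Cons f fs)
  then show ?case using extend_least[of K J f] by auto
qed simp

lemma extend_commute: "extend (extend J f) g = extend (extend J g) f"
proof -
  have "extend (extend J f) g \<subseteq> extend (extend J g) f" for f g
  proof
    fix x assume "x \<in> extend (extend J f) g"
    then obtain a b c where "a \<in> J" "b \<in> R" "c \<in> R" "x = (a + f * b) + g * c"
      by (elim extendE) blast
    then show "x \<in> extend (extend J g) f"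
      using extendI[OF extendI[of a J c g], of b f] by (simp add: algebra_simps)
  qed
  then show ?thesis by blast
qed

lemma foldl_extend_commute: "foldl extend (extend J f) gs = extend (foldl extend J gs) f"
proof (induction gs arbitrary: J)
  case (Cons g gs)
  show ?case using Cons[of "extend J g"] by (simp add: extend_commute[of J f g])
qed simp

section \<open>Weakly regular sequences and their powers\<close>

text \<open>A regular sequence on R/J without the properness condition; for sequences in the
  irrelevant ideal properness is recovered later.\<close>

fun weakly_regular :: "'a set \<Rightarrow> 'a list \<Rightarrow> bool" where
  "weakly_regular J [] \<longleftrightarrow> True"
| "weakly_regular J (f # fs) \<longleftrightarrow> nzd f J \<and> weakly_regular (extend J f) fs"

lemma weakly_regular_append:
  "weakly_regular J (fs @ gs) \<longleftrightarrow> weakly_regular J fs \<and> weakly_regular (foldl extend J fs) gs"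
  by (induction fs arbitrary: J) auto

lemma weakly_regular_iff_nth:
  "weakly_regular J fs \<longleftrightarrow> (\<forall>i<length fs. nzd (fs ! i) (foldl extend J (take i fs)))"
proof (induction fs arbitrary: J)
  case (Cons f fs)
  show ?case
    unfolding weakly_regular.simps Cons by (simp add: All_less_Suc2)
qed simp

text \<open>The half of the permutability of regular sequences that needs no local hypothesis: if f
  y = a + g c, then g c lies in K + f R, so c = b + f c', and f cancels from f (y - g c') = a + g
  b.\<close>

lemma weakly_regular_Cons_nzd:
  assumes "weakly_regular J (f # gs)" "is_ideal J" "f \<in> R" "set gs \<subseteq> R"
  shows "nzd f (foldl extend J gs)"
  using assms
proof (induction gs rule: rev_induct)
  case (snoc g gs)
  let ?K = "foldl extend J gs"
  have K: "is_ideal ?K" using foldl_extend_ideal snoc.prems by auto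
  have IH: "nzd f ?K" using snoc by (auto simp: weakly_regular_append)
  have g: "nzd g (extend ?K f)"
    using snoc.prems(1) by (simp add: weakly_regular_append foldl_extend_commute)
  show ?case unfolding nzd_def foldl_append foldl.simps
  proof (intro ballI impI)
    fix y assume y: "y \<in> R" "f * y \<in> extend ?K g"
    then obtain a c where ac: "a \<in> ?K" "c \<in> R" "f * y = a + g * c" by (elim extendE)
    have "g * c = - a + f * y" using ac by simp
    then have "g * c \<in> extend ?K f" using extendI[OF ideal_uminus[OF K ac(1)] y(1)] by simp
    then have "c \<in> extend ?K f" using nzdD[OF g ac(2)] by simp
    then obtain b c' where c': "b \<in> ?K" "c' \<in> R" "c = b + f * c'" by (elim extendE)
    have gR: "g \<in> R" using snoc.prems by simp
    have "f * (y - g * c') = a + g * b" using ac c' by (simp add: algebra_simps)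
    also have "\<dots> \<in> ?K" using ac c' K gR by (auto intro: ideal_add ideal_mult)
    finally have "y - g * c' \<in> ?K" using nzdD[OF IH] y(1) gR c'(2) by (simp add: diff_closed mult_closed)
    then show "y \<in> extend ?K g" using extendI[of "y - g * c'" ?K c' g] c'(2) by simp
  qed
qed simp

text \<open>One factor at a time: g y in K + f h R gives y = b + f z; cancelling f modulo K, which
  \<open>weakly_regular_Cons_nzd\<close> permits, leaves g z in K + h R, and so z is in K + h
  R.\<close>

lemma weakly_regular_Cons_mult:
  assumes "weakly_regular J (f # gs)" "weakly_regular J (h # gs)" "is_ideal J"
    "f \<in> R" "h \<in> R" "set gs \<subseteq> R"
  shows "weakly_regular J (f * h # gs)"
  using assms
proof (induction gs rule: rev_induct)
  case Nil
  have "x \<in> J" if "x \<in> R" "f * h * x \<in> J" for x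
  proof -
    have "h * x \<in> J" using nzdD[of f J "h * x"] that Nil.prems by (simp add: mult.assoc mult_closed)
    then show ?thesis using nzdD[of h J x] that Nil.prems by simp
  qed
  then show ?case by (simp add: nzd_def)
next
  case (snoc g gs)
  let ?K = "foldl extend J gs"
  have K: "is_ideal ?K" using foldl_extend_ideal snoc.prems by auto
  have gR: "g \<in> R" using snoc.prems by simp
  have IH: "weakly_regular J (f * h # gs)" using snoc by (auto simp: weakly_regular_append)
  have gf: "nzd g (extend ?K f)" and gh: "nzd g (extend ?K h)"
    using snoc.prems(1,2) by (simp_all add: weakly_regular_append foldl_extend_commute)
  have f: "nzd f ?K" using snoc.prems by (intro weakly_regular_Cons_nzd) (auto simp: weakly_regular_append)
  have "nzd g (extend ?K (f * h))" unfolding nzd_def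
  proof (intro ballI impI)
    fix y assume y: "y \<in> R" "g * y \<in> extend ?K (f * h)"
    then obtain a c where ac: "a \<in> ?K" "c \<in> R" "g * y = a + f * h * c" by (elim extendE)
    then have "g * y \<in> extend ?K f" using extendI[of a ?K "h * c" f] snoc.prems(5)
      by (simp add: mult.assoc mult_closed)
    then have "y \<in> extend ?K f" using nzdD[OF gf y(1)] by simp
    then obtain b z where z: "b \<in> ?K" "z \<in> R" "y = b + f * z" by (elim extendE)
    have "f * (g * z - h * c) = a - g * b" using ac z by (simp add: algebra_simps)
    also have "\<dots> \<in> ?K" using ac z K gR by (auto intro: ideal_diff ideal_mult)
    finally have "g * z - h * c \<in> ?K"
      using nzdD[OF f] z ac gR snoc.prems(5) by (simp add: diff_closed mult_closed)
    then have "g * z \<in> extend ?K h" using extendI[of "g * z - h * c" ?K c h] ac by simp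
    then have "z \<in> extend ?K h" using nzdD[OF gh z(2)] by simp
    then obtain b' w where w: "b' \<in> ?K" "w \<in> R" "z = b' + h * w" by (elim extendE)
    have "y = (b + f * b') + f * h * w" using z w by (simp add: algebra_simps)
    moreover have "b + f * b' \<in> ?K" using z w K snoc.prems by (auto intro: ideal_add ideal_mult)
    ultimately show "y \<in> extend ?K (f * h)" using extendI w(2) by simp
  qed
  then show ?case using IH by (simp add: weakly_regular_append foldl_extend_commute)
qed

lemma weakly_regular_Cons_power:
  assumes "weakly_regular J (f # gs)" "is_ideal J" "f \<in> R" "set gs \<subseteq> R"
  shows "weakly_regular J (f ^ Suc k # gs)"
proof (induction k)
  case (Suc k)
  show ?case using weakly_regular_Cons_mult[OF assms(1) Suc] assms power_closed[of f "Suc k"] by simp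
qed (use assms in simp)

lemma weakly_regular_powers:
  assumes "weakly_regular J fs" "is_ideal J" "set fs \<subseteq> R"
  shows "weakly_regular J (map (\<lambda>f. f ^ Suc k) fs)"
  using assms
proof (induction fs arbitrary: J)
  case (Cons f fs)
  have "weakly_regular J (f ^ Suc k # fs)"
    using weakly_regular_Cons_power[of J f fs k] Cons.prems by simp
  moreover have "is_ideal (extend J (f ^ Suc k))"
    using extend_ideal[of J "f ^ Suc k"] power_closed[of f "Suc k"] Cons.prems by simp
  ultimately show ?case using Cons.IH[of "extend J (f ^ Suc k)"] Cons.prems by simp
qed simp

lemma list_monomial_closed: "set fs \<subseteq> R \<Longrightarrow> list_monomial fs ks \<in> R"
  by (induction fs ks rule: list_monomial.induct) (auto intro: one_closed mult_closed power_closed)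

text \<open>Only the terms with the least exponent t of the first member matter: f ^ t cancels
  modulo \<open>J 0\<close>, and higher terms vanish modulo \<open>J 1\<close>, which contains f.
  What is left is a relation in the other members along the shifted chain, and finally a unit times
  u. The chain and u are arbitrary so that chains of primes (with u = 1) and regular sequences are
  both covered.\<close>

lemma relation_chain:
  assumes "\<And>i. i < length fs \<Longrightarrow> nzd (fs ! i) (J i)"
    and "\<And>i. i < length fs \<Longrightarrow> J i \<subseteq> J (Suc i) \<and> fs ! i \<in> J (Suc i)"
    and "\<And>i. i \<le> length fs \<Longrightarrow> is_ideal (J i)"
    and "set fs \<subseteq> R" "u \<in> R" "finite A"
    and "\<And>\<alpha>. \<alpha> \<in> A \<Longrightarrow> length \<alpha> = length fs"
    and "\<And>\<alpha>. \<alpha> \<in> A \<Longrightarrow> c \<alpha> \<in> R \<and> (c \<alpha> \<noteq> 0 \<longrightarrow> (\<exists>b\<in>R. b * c \<alpha> = 1))"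
    and "\<exists>\<alpha>\<in>A. c \<alpha> \<noteq> 0"
    and "(\<Sum>\<alpha>\<in>A. c \<alpha> * list_monomial fs \<alpha>) * u \<in> J 0"
  shows "u \<in> J (length fs)"
  using assms
proof (induction fs arbitrary: J A c)
  case Nil
  have "A = {[]}" using Nil.prems(7,9) by auto
  then obtain b where b: "b \<in> R" "b * c [] = 1" using Nil.prems(8,9) by auto
  have "c [] * u \<in> J 0" using Nil.prems(10) \<open>A = {[]}\<close> by simp
  then have "b * (c [] * u) \<in> J 0" using ideal_mult[OF Nil.prems(3)] b by simp
  then show ?case using b by (simp add: mult.assoc[symmetric])
next
  case (Cons f fs)
  note J = Cons.prems(3)
  have f: "f \<in> R" using Cons.prems(4) by simp
  \<comment> \<open>Zero coefficients are dropped, so that the least exponent is attained by a term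
    with an invertible coefficient.\<close>
  define B where "B = {\<alpha> \<in> A. c \<alpha> \<noteq> 0}"
  define t where "t = Min (hd ` B)"
  have fB: "finite B" "B \<noteq> {}" using Cons.prems(6,9) by (auto simp: B_def)
  have len: "\<alpha> = hd \<alpha> # tl \<alpha> \<and> length (tl \<alpha>) = length fs" if "\<alpha> \<in> B" for \<alpha>
    using Cons.prems(7)[of \<alpha>] that by (cases \<alpha>) (auto simp: B_def)
  have t: "t \<le> hd \<alpha>" if "\<alpha> \<in> B" for \<alpha> using fB that by (simp add: t_def)
  have "t \<in> hd ` B" using Min_in[of "hd ` B"] fB by (simp add: t_def)
  then obtain \<alpha>0 where \<alpha>0: "\<alpha>0 \<in> B" "hd \<alpha>0 = t" by blast
  define S where "S = (\<Sum>\<alpha>\<in>B. c \<alpha> * (f ^ (hd \<alpha> - t) * list_monomial fs (tl \<alpha>)))"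
  have cR: "c \<alpha> \<in> R" if "\<alpha> \<in> B" for \<alpha> using Cons.prems(8) that by (simp add: B_def)
  have mR: "list_monomial fs ks \<in> R" for ks using Cons.prems(4) list_monomial_closed by simp
  have SR: "S \<in> R" unfolding S_def by (intro sum_closed mult_closed cR mR power_closed f)
  have "(\<Sum>\<alpha>\<in>A. c \<alpha> * list_monomial (f # fs) \<alpha>) = (\<Sum>\<alpha>\<in>B. c \<alpha> * list_monomial (f # fs) \<alpha>)"
    using Cons.prems(6) by (intro sum.mono_neutral_right) (auto simp: B_def)
  also have "\<dots> = (\<Sum>\<alpha>\<in>B. f ^ t * (c \<alpha> * (f ^ (hd \<alpha> - t) * list_monomial fs (tl \<alpha>))))"
  proof (rule sum.cong)
    fix \<alpha> assume \<alpha>: "\<alpha> \<in> B"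
    have "list_monomial (f # fs) \<alpha> = f ^ (t + (hd \<alpha> - t)) * list_monomial fs (tl \<alpha>)"
      using len[OF \<alpha>] t[OF \<alpha>] by (metis le_add_diff_inverse list_monomial.simps(1))
    then show "c \<alpha> * list_monomial (f # fs) \<alpha> =
        f ^ t * (c \<alpha> * (f ^ (hd \<alpha> - t) * list_monomial fs (tl \<alpha>)))"
      by (simp add: power_add algebra_simps)
  qed simp
  also have "\<dots> = f ^ t * S" by (simp add: S_def sum_distrib_left)
  finally have "f ^ t * (S * u) \<in> J 0" using Cons.prems(10) by (simp add: mult.assoc)
  then have "S * u \<in> J 0"
    using nzd_power[of f "J 0"] Cons.prems(1)[of 0] f SR Cons.prems(5) by (auto intro: mult_closed)
  then have Su: "S * u \<in> J 1" using Cons.prems(2)[of 0] by auto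
  \<comment> \<open>The lowest terms in f. All their heads equal t, so \<open>tl\<close> is
    injective on them and no two coefficients merge in the shorter relation.\<close>
  define D where "D = {\<alpha> \<in> B. hd \<alpha> = t}"
  have J1: "is_ideal (J 1)" using J by simp
  have fJ: "f \<in> J 1" using Cons.prems(2)[of 0] by simp
  have "S = (\<Sum>\<alpha>\<in>D. c \<alpha> * (f ^ (hd \<alpha> - t) * list_monomial fs (tl \<alpha>)))
      + (\<Sum>\<alpha>\<in>B - D. c \<alpha> * (f ^ (hd \<alpha> - t) * list_monomial fs (tl \<alpha>)))"
    unfolding S_def using fB by (subst sum.subset_diff[of D B]) (auto simp: D_def)
  moreover have "(\<Sum>\<alpha>\<in>B - D. c \<alpha> * (f ^ (hd \<alpha> - t) * list_monomial fs (tl \<alpha>))) * u \<in> J 1"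
  proof (intro ideal_mult_right[OF J1 Cons.prems(5)] ideal_sum[OF J1])
    fix \<alpha> assume \<alpha>: "\<alpha> \<in> B - D"
    then have "hd \<alpha> - t = Suc (hd \<alpha> - t - 1)" using t[of \<alpha>] by (auto simp: D_def)
    then have "f ^ (hd \<alpha> - t) \<in> J 1"
      using ideal_mult_right[OF J1 power_closed[OF f] fJ] by (metis power_Suc)
    then show "c \<alpha> * (f ^ (hd \<alpha> - t) * list_monomial fs (tl \<alpha>)) \<in> J 1"
      using \<alpha> by (intro ideal_mult[OF J1 cR] ideal_mult_right[OF J1 mR]) auto
  qed
  ultimately have "S * u - (\<Sum>\<alpha>\<in>D. c \<alpha> * (f ^ (hd \<alpha> - t) * list_monomial fs (tl \<alpha>))) * u \<in> J 1"
    by (simp add: algebra_simps)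
  then have "(\<Sum>\<alpha>\<in>D. c \<alpha> * (f ^ (hd \<alpha> - t) * list_monomial fs (tl \<alpha>))) * u \<in> J 1"
    using ideal_cong[OF J1] Su by blast
  also have "(\<Sum>\<alpha>\<in>D. c \<alpha> * (f ^ (hd \<alpha> - t) * list_monomial fs (tl \<alpha>)))
      = (\<Sum>\<beta>\<in>tl ` D. c (t # \<beta>) * list_monomial fs \<beta>)"
  proof -
    have D: "hd \<alpha> = t" "t # tl \<alpha> = \<alpha>" if "\<alpha> \<in> D" for \<alpha>
      using that len[of \<alpha>] by (auto simp: D_def)
    then have "inj_on tl D" by (metis inj_onI)
    then show ?thesis by (simp add: sum.reindex D)
  qed
  finally have rel: "(\<Sum>\<beta>\<in>tl ` D. c (t # \<beta>) * list_monomial fs \<beta>) * u \<in> J 1" .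
  have D: "t # tl \<alpha> = \<alpha>" "\<alpha> \<in> A" "c \<alpha> \<noteq> 0" "length (tl \<alpha>) = length fs" if "\<alpha> \<in> D" for \<alpha>
    using that len[of \<alpha>] by (auto simp: D_def B_def)
  have "u \<in> (\<lambda>i. J (Suc i)) (length fs)"
  proof (rule Cons.IH)
    show "\<exists>\<beta>\<in>tl ` D. c (t # \<beta>) \<noteq> 0" using \<alpha>0 D[of \<alpha>0] by (auto simp: D_def)
    show "finite (tl ` D)" using fB by (simp add: D_def)
    show "length \<beta> = length fs" if "\<beta> \<in> tl ` D" for \<beta> using that D by auto
    show "c (t # \<beta>) \<in> R \<and> (c (t # \<beta>) \<noteq> 0 \<longrightarrow> (\<exists>b\<in>R. b * c (t # \<beta>) = 1))" if "\<beta> \<in> tl ` D" for \<beta>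
      using that D Cons.prems(8) by fastforce
    show "nzd (fs ! i) (J (Suc i))" if "i < length fs" for i using Cons.prems(1)[of "Suc i"] that by simp
    show "J (Suc i) \<subseteq> J (Suc (Suc i)) \<and> fs ! i \<in> J (Suc (Suc i))" if "i < length fs" for i
      using Cons.prems(2)[of "Suc i"] that by simp
  qed (use Cons.prems J rel in auto)
  then show ?case by simp
qed

end

text \<open>Gaussian elimination: equation b is solved for an unknown \<open>a0\<close> with nonzero
  coefficient, and the induction handles the other equations with \<open>a0\<close>
  eliminated.\<close>

lemma homogeneous_system_nontrivial_solution:
  fixes M :: "'a \<Rightarrow> 'b \<Rightarrow> 'k::field"
  assumes "finite B" "finite A" "card B < card A"
  shows "\<exists>c. (\<exists>a\<in>A. c a \<noteq> 0) \<and> (\<forall>b\<in>B. (\<Sum>a\<in>A. c a * M a b) = 0)"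
  using assms
proof (induction B arbitrary: A M rule: finite_induct)
  case empty
  then show ?case by (intro exI[of _ "\<lambda>_. 1"]) (auto simp: card_gt_0_iff)
next
  case (insert b B)
  show ?case
  proof (cases "\<forall>a\<in>A. M a b = 0")
    case True
    then show ?thesis using insert.IH[of A M] insert.prems insert.hyps by auto
  next
    case False
    then obtain a0 where a0: "a0 \<in> A" "M a0 b \<noteq> 0" by blast
    define M' where "M' a x = M a x - M a b / M a0 b * M a0 x" for a x
    obtain c where c: "\<exists>a\<in>A - {a0}. c a \<noteq> 0" "\<forall>x\<in>B. (\<Sum>a\<in>A - {a0}. c a * M' a x) = 0"
      using insert.IH[of "A - {a0}" M'] insert.prems insert.hyps a0 by (auto simp: less_diff_conv)
    \<comment> \<open>The value at \<open>a0\<close> is the one that equation b forces.\<close>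
    define c' where "c' a = (if a = a0 then - (\<Sum>a\<in>A - {a0}. c a * (M a b / M a0 b)) else c a)" for a
    have eq: "(\<Sum>a\<in>A. c' a * M a x) = (\<Sum>a\<in>A - {a0}. c a * M' a x)" for x
    proof -
      have "(\<Sum>a\<in>A. c' a * M a x) = c' a0 * M a0 x + (\<Sum>a\<in>A - {a0}. c' a * M a x)"
        using insert.prems(1) a0 by (simp add: sum.remove)
      also have "(\<Sum>a\<in>A - {a0}. c' a * M a x) = (\<Sum>a\<in>A - {a0}. c a * M a x)"
        by (intro sum.cong) (auto simp: c'_def)
      also have "c' a0 * M a0 x + \<dots> = (\<Sum>a\<in>A - {a0}. c a * M' a x)"
        by (simp add: c'_def M'_def algebra_simps sum_subtractf sum_distrib_left sum_distrib_right)
      finally show ?thesis .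
    qed
    have "(\<Sum>a\<in>A. c' a * M a x) = 0" if "x \<in> insert b B" for x
      using that c(2) a0 unfolding eq by (auto simp: M'_def)
    moreover have "\<exists>a\<in>A. c' a \<noteq> 0" using c(1) by (auto simp: c'_def)
    ultimately show ?thesis by blast
  qed
qed

section \<open>Polynomials and substitutions\<close>

definition polys :: "nat set \<Rightarrow> 'k::field mpoly set" where
  "polys V = {f. \<forall>m\<in>Poly_Mapping.keys f. Poly_Mapping.keys m \<subseteq> V}"

definition const :: "'k::field \<Rightarrow> 'k mpoly" where
  "const c = Poly_Mapping.single 0 c"

lemma keys_plus_nat: "Poly_Mapping.keys (a + b) = Poly_Mapping.keys a \<union> Poly_Mapping.keys b"
  for a b :: "nat \<Rightarrow>\<^sub>0 nat"
  by (auto simp: in_keys_iff lookup_add)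

lemma keys_multE:
  assumes "m \<in> Poly_Mapping.keys (f * g)"
  obtains a b where "a \<in> Poly_Mapping.keys f" "b \<in> Poly_Mapping.keys g" "m = a + b"
  using keys_mult[of f g] assms by blast

interpretation P: comm_subring "polys V" for V
proof
  fix a b :: "'b::field mpoly" assume ab: "a \<in> polys V" "b \<in> polys V"
  show "a + b \<in> polys V" using ab keys_add[of a b] by (auto simp: polys_def)
  show "a * b \<in> polys V" using ab unfolding polys_def
    by (auto elim!: keys_multE simp: keys_plus_nat) blast+
next
  fix a :: "'b::field mpoly" assume "a \<in> polys V"
  then show "- a \<in> polys V" by (simp add: polys_def in_keys_iff)
qed (simp add: polys_def)

lemma const_polys: "const c \<in> polys V"
  by (simp add: const_def polys_def)

lemma mvar_polys: "i \<in> V \<Longrightarrow> mvar i \<in> polys V"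
  by (simp add: mvar_def polys_def)

lemma single_polys: "Poly_Mapping.keys m \<subseteq> V \<Longrightarrow> Poly_Mapping.single m c \<in> polys V"
  by (simp add: polys_def)

lemma const_inverse: "c \<noteq> 0 \<Longrightarrow> const (inverse c) * const c = 1"
  by (simp add: const_def mult_single)

lemma const_eq_0_iff: "const c = 0 \<longleftrightarrow> c = 0"
  by (metis const_def lookup_single_eq lookup_zero single_zero)

lemma lookup_const_mult: "Poly_Mapping.lookup (const c * f) m = c * Poly_Mapping.lookup f m"
  by (simp add: const_def lookup_mult lookup_single when_mult mult_when Sum_any_when_independent)

lemma poly_eq_sum_singles:
  "f = (\<Sum>m\<in>Poly_Mapping.keys f. Poly_Mapping.single m (Poly_Mapping.lookup f m))"
  by (rule poly_mapping_eqI)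
    (simp add: lookup_sum lookup_single when_def in_keys_iff)

text \<open>Every monomial of a product is a multiple of a monomial of the second factor. Edge
  ideals and the ideal of the degree argument have this form, so membership in them is tested
  monomial by monomial.\<close>

lemma monomial_ideal:
  assumes "\<And>m m'. Q m \<Longrightarrow> Q (m' + m)"
  shows "P.is_ideal V {f \<in> polys V. \<forall>m\<in>Poly_Mapping.keys f. Q m}"
proof (rule P.is_idealI)
  fix a b :: "'k::field mpoly"
  assume "a \<in> {f \<in> polys V. \<forall>m\<in>Poly_Mapping.keys f. Q m}" "b \<in> {f \<in> polys V. \<forall>m\<in>Poly_Mapping.keys f. Q m}"
  then show "a + b \<in> {f \<in> polys V. \<forall>m\<in>Poly_Mapping.keys f. Q m}"
    using keys_add[of a b] by (auto intro: P.add_closed)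
next
  fix r a :: "'k::field mpoly"
  assume "r \<in> polys V" "a \<in> {f \<in> polys V. \<forall>m\<in>Poly_Mapping.keys f. Q m}"
  then show "r * a \<in> {f \<in> polys V. \<forall>m\<in>Poly_Mapping.keys f. Q m}"
    by (auto intro: P.mult_closed assms elim!: keys_multE)
qed (auto intro: P.zero_closed)

section \<open>Substitution homomorphisms and their kernels\<close>

definition monom_subst :: "(nat \<Rightarrow> 'k::field mpoly) \<Rightarrow> (nat \<Rightarrow>\<^sub>0 nat) \<Rightarrow> 'k mpoly" where
  "monom_subst \<rho> m = (\<Prod>v\<in>Poly_Mapping.keys m. \<rho> v ^ Poly_Mapping.lookup m v)"

definition subst :: "(nat \<Rightarrow> 'k::field mpoly) \<Rightarrow> 'k mpoly \<Rightarrow> 'k mpoly" where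
  "subst \<rho> f = (\<Sum>m\<in>Poly_Mapping.keys f. const (Poly_Mapping.lookup f m) * monom_subst \<rho> m)"

lemma monom_subst_superset:
  "finite A \<Longrightarrow> Poly_Mapping.keys m \<subseteq> A \<Longrightarrow> monom_subst \<rho> m = (\<Prod>v\<in>A. \<rho> v ^ Poly_Mapping.lookup m v)"
  unfolding monom_subst_def by (intro prod.mono_neutral_left) (auto simp: in_keys_iff)

lemma monom_subst_add: "monom_subst \<rho> (a + b) = monom_subst \<rho> a * monom_subst \<rho> b"
proof -
  let ?A = "Poly_Mapping.keys a \<union> Poly_Mapping.keys b"
  show ?thesis
    using monom_subst_superset[of ?A _ \<rho>]
    by (simp add: keys_plus_nat lookup_add power_add prod.distrib)
qed

lemma monom_subst_mvar: "monom_subst mvar m = Poly_Mapping.single m (1::'k::field)"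
proof -
  have power: "mvar v ^ k = Poly_Mapping.single (Poly_Mapping.single v k) (1::'k)" for v k
    by (induction k) (simp_all add: mvar_def mult_single flip: single_add)
  have "(\<Prod>v\<in>A. Poly_Mapping.single (g v) (1::'k)) = Poly_Mapping.single (\<Sum>v\<in>A. g v) 1" if "finite A"
    for A and g :: "nat \<Rightarrow> nat \<Rightarrow>\<^sub>0 nat"
    using that by (induction A) (simp_all add: mult_single)
  then have "monom_subst mvar m = Poly_Mapping.single
      (\<Sum>v\<in>Poly_Mapping.keys m. Poly_Mapping.single v (Poly_Mapping.lookup m v)) (1::'k)"
    by (simp add: monom_subst_def power)
  moreover have "(\<Sum>v\<in>Poly_Mapping.keys m. Poly_Mapping.single v (Poly_Mapping.lookup m v)) = m"
    by (rule poly_mapping_eqI) (simp add: lookup_sum lookup_single when_def in_keys_iff)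
  ultimately show ?thesis by simp
qed

lemma subst_superset:
  "finite A \<Longrightarrow> Poly_Mapping.keys f \<subseteq> A \<Longrightarrow>
    subst \<rho> f = (\<Sum>m\<in>A. const (Poly_Mapping.lookup f m) * monom_subst \<rho> m)"
  unfolding subst_def by (intro sum.mono_neutral_left) (auto simp: in_keys_iff const_eq_0_iff)

lemma const_add: "const (a + b) = const a + const b"
  by (simp add: const_def single_add)

lemma const_mult: "const (a * b) = const a * const b"
  by (simp add: const_def mult_single)

lemma subst_add: "subst \<rho> (f + g) = subst \<rho> f + subst \<rho> g"
proof -
  let ?A = "Poly_Mapping.keys f \<union> Poly_Mapping.keys g"
  have "subst \<rho> (f + g) = (\<Sum>m\<in>?A. const (Poly_Mapping.lookup (f + g) m) * monom_subst \<rho> m)"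
    by (intro subst_superset keys_add) simp
  also have "\<dots> = (\<Sum>m\<in>?A. const (Poly_Mapping.lookup f m) * monom_subst \<rho> m) +
      (\<Sum>m\<in>?A. const (Poly_Mapping.lookup g m) * monom_subst \<rho> m)"
    by (simp add: lookup_add const_add distrib_right sum.distrib)
  also have "\<dots> = subst \<rho> f + subst \<rho> g"
    by (simp add: subst_superset[of ?A])
  finally show ?thesis .
qed

lemma subst_zero: "subst \<rho> 0 = 0"
  by (simp add: subst_def)

lemma subst_sum: "subst \<rho> (sum f A) = (\<Sum>x\<in>A. subst \<rho> (f x))"
  by (induction A rule: infinite_finite_induct) (auto simp: subst_add subst_zero)

lemma subst_diff: "subst \<rho> (f - g) = subst \<rho> f - subst \<rho> g"
  using subst_add[of \<rho> "f - g" g] by simp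

lemma subst_single: "subst \<rho> (Poly_Mapping.single m c) = const c * monom_subst \<rho> m"
  by (simp add: subst_def const_eq_0_iff)

lemma subst_mvar: "subst \<rho> (mvar i) = \<rho> i"
  by (simp add: mvar_def subst_single monom_subst_def) (simp add: const_def)

lemma subst_mult: "subst \<rho> (f * g) = subst \<rho> f * subst \<rho> g"
proof -
  let ?c = Poly_Mapping.lookup and ?k = Poly_Mapping.keys
  have "f * g = (\<Sum>a\<in>?k f. Poly_Mapping.single a (?c f a)) * (\<Sum>b\<in>?k g. Poly_Mapping.single b (?c g b))"
    by (rule arg_cong2[where f = "(*)"]) (rule poly_eq_sum_singles)+
  also have "\<dots> = (\<Sum>a\<in>?k f. \<Sum>b\<in>?k g. Poly_Mapping.single (a + b) (?c f a * ?c g b))"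
    by (simp add: sum_product mult_single)
  finally have "subst \<rho> (f * g) = subst \<rho> (\<Sum>a\<in>?k f. \<Sum>b\<in>?k g.
      Poly_Mapping.single (a + b) (?c f a * ?c g b))" by (rule arg_cong)
  then have "subst \<rho> (f * g) = (\<Sum>a\<in>?k f. \<Sum>b\<in>?k g.
      const (?c f a * ?c g b) * monom_subst \<rho> (a + b))"
    by (simp add: subst_sum subst_single)
  also have "\<dots> = subst \<rho> f * subst \<rho> g"
    by (simp add: subst_def sum_product const_mult monom_subst_add ac_simps)
  finally show ?thesis .
qed

text \<open>A congruence that holds for every variable holds for every polynomial. Consequently such
  a J contains the kernel of the substitution; this is how kernels are bounded from above.\<close>

lemma diff_subst_mem_ideal:
  assumes J: "P.is_ideal V J" and \<rho>: "\<And>v. v \<in> V \<Longrightarrow> \<rho> v \<in> polys V \<and> mvar v - \<rho> v \<in> J"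
    and f: "f \<in> polys V"
  shows "f - subst \<rho> f \<in> J"
proof -
  let ?c = "Poly_Mapping.lookup f"
  have "Poly_Mapping.single m (?c m) = const (?c m) * monom_subst mvar m" for m
    by (simp add: monom_subst_mvar const_def mult_single)
  then have "f - subst \<rho> f =
      (\<Sum>m\<in>Poly_Mapping.keys f. const (?c m) * (monom_subst mvar m - monom_subst \<rho> m))"
    by (subst poly_eq_sum_singles[of f]) (simp add: subst_def right_diff_distrib sum_subtractf)
  also have "\<dots> \<in> J"
  proof (intro P.ideal_sum[OF J] P.ideal_mult[OF J] const_polys)
    fix m assume "m \<in> Poly_Mapping.keys f"
    then have "Poly_Mapping.keys m \<subseteq> V" using f by (auto simp: polys_def)
    then show "monom_subst mvar m - monom_subst \<rho> m \<in> J"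
      unfolding monom_subst_def using \<rho> mvar_polys[of _ V]
      by (intro P.ideal_prod_cong[OF J])
        (blast intro: P.power_closed P.ideal_power_cong[OF J])
  qed
  finally show ?thesis .
qed

definition subst_kernel :: "nat set \<Rightarrow> (nat \<Rightarrow> 'k::field mpoly) \<Rightarrow> 'k mpoly set" where
  "subst_kernel V \<rho> = {f \<in> polys V. subst \<rho> f = 0}"

lemma subst_kernel_ideal: "P.is_ideal V (subst_kernel V \<rho>)"
  by (rule P.is_idealI)
    (auto simp: subst_kernel_def subst_add subst_mult subst_zero
      intro: P.zero_closed P.add_closed P.mult_closed)

text \<open>The polynomials in all variables over a field have no zero divisors. Primes are
  therefore produced as kernels, without any study of generators.\<close>

lemma subst_kernel_prime:
  "a \<in> polys V \<Longrightarrow> b \<in> polys V \<Longrightarrow> a * b \<in> subst_kernel V \<rho> \<Longrightarrow>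
    a \<in> subst_kernel V \<rho> \<or> b \<in> subst_kernel V \<rho>"
  by (simp add: subst_kernel_def subst_mult)

lemma nzd_subst_kernel:
  "a \<in> polys V \<Longrightarrow> subst \<rho> a \<noteq> 0 \<Longrightarrow> P.nzd V a (subst_kernel V \<rho>)"
  unfolding P.nzd_def by (auto simp: subst_kernel_def subst_mult)

lemma mvar_eq_iff: "mvar i = (mvar j :: 'k::field mpoly) \<longleftrightarrow> i = j"
proof
  assume "mvar i = (mvar j :: 'k mpoly)"
  then have "Poly_Mapping.keys (mvar i :: 'k mpoly) = Poly_Mapping.keys (mvar j :: 'k mpoly)" by simp
  then have "Poly_Mapping.keys (Poly_Mapping.single i (1::nat)) = Poly_Mapping.keys (Poly_Mapping.single j (1::nat))"
    by (simp add: mvar_def)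
  then show "i = j" by simp
qed simp

lemma mvar_nonzero: "mvar i \<noteq> 0"
  by (metis mvar_def lookup_single_eq lookup_zero zero_neq_one)

section \<open>Exponent bounds and algebraic dependence\<close>

text \<open>A bound on each exponent rather than on the total degree: then at most (D + 1) ^ |A|
  monomials in the variables from A have to be counted.\<close>

definition exponents_le :: "nat \<Rightarrow> 'k::field mpoly \<Rightarrow> bool" where
  "exponents_le d f \<longleftrightarrow> (\<forall>m\<in>Poly_Mapping.keys f. \<forall>v. Poly_Mapping.lookup m v \<le> d)"

lemma exponents_le_mult:
  "exponents_le d f \<Longrightarrow> exponents_le e g \<Longrightarrow> exponents_le (d + e) (f * g)"
  unfolding exponents_le_def by (auto elim!: keys_multE simp: lookup_add add_mono)

lemma exponents_le_mono: "exponents_le d f \<Longrightarrow> d \<le> e \<Longrightarrow> exponents_le e f"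
  unfolding exponents_le_def using le_trans by blast

lemma exponents_le_power: "exponents_le d f \<Longrightarrow> exponents_le (k * d) (f ^ k)"
proof (induction k)
  case (Suc k)
  then show ?case using exponents_le_mult[of d f "k * d" "f ^ k"] by simp
qed (simp add: exponents_le_def)

lemma exponents_le_exists: "\<exists>d. exponents_le d f"
proof -
  let ?S = "\<Union>m\<in>Poly_Mapping.keys f. Poly_Mapping.lookup m ` Poly_Mapping.keys m"
  have "Poly_Mapping.lookup m v \<le> Max (insert 0 ?S)" if "m \<in> Poly_Mapping.keys f" for m v
    using that by (cases "v \<in> Poly_Mapping.keys m") (auto simp: in_keys_iff intro!: Max_ge)
  then show ?thesis unfolding exponents_le_def by blast
qed

lemma exponents_le_list_exists: "\<exists>d. \<forall>f\<in>set fs. exponents_le d f"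
proof (induction fs)
  case (Cons f fs)
  obtain d e where "\<forall>f\<in>set fs. exponents_le d f" "exponents_le e f"
    using Cons exponents_le_exists by blast
  then have "\<forall>f\<in>set (f # fs). exponents_le (max d e) f" by (auto intro: exponents_le_mono)
  then show ?case by blast
qed simp

lemma exponents_le_list_monomial:
  "\<forall>f\<in>set fs. exponents_le d f \<Longrightarrow> set ks \<subseteq> {..N} \<Longrightarrow>
    exponents_le (length fs * (N * d)) (list_monomial fs ks)"
proof (induction fs ks rule: list_monomial.induct)
  case (1 f fs k ks)
  have "exponents_le (N * d) (f ^ k)"
    using exponents_le_power[of d f k] 1 by (auto intro: exponents_le_mono)
  then show ?case using 1 exponents_le_mult[of "N * d" "f ^ k" "length fs * (N * d)"] by simp
qed (auto simp: exponents_le_def)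

lemma card_bounded_monomials:
  assumes "finite A"
  shows "finite {m. Poly_Mapping.keys m \<subseteq> A \<and> (\<forall>v. Poly_Mapping.lookup m v \<le> (D::nat))} \<and>
    card {m. Poly_Mapping.keys m \<subseteq> A \<and> (\<forall>v. Poly_Mapping.lookup m v \<le> D)} \<le> (D + 1) ^ card A"
proof -
  let ?M = "{m. Poly_Mapping.keys m \<subseteq> A \<and> (\<forall>v. Poly_Mapping.lookup m v \<le> D)}"
  let ?r = "\<lambda>m. restrict (Poly_Mapping.lookup m) A"
  have inj: "inj_on ?r ?M"
  proof (rule inj_onI)
    fix a b assume ab: "a \<in> ?M" "b \<in> ?M" "?r a = ?r b"
    show "a = b"
    proof (rule poly_mapping_eqI)
      fix v
      show "Poly_Mapping.lookup a v = Poly_Mapping.lookup b v"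
      proof (cases "v \<in> A")
        case True then show ?thesis using ab(3) by (metis restrict_apply')
      next
        case False
        then have "v \<notin> Poly_Mapping.keys a" "v \<notin> Poly_Mapping.keys b" using ab by auto
        then show ?thesis by (simp add: in_keys_iff)
      qed
    qed
  qed
  have sub: "?r ` ?M \<subseteq> A \<rightarrow>\<^sub>E {..D}" by auto
  have fin: "finite (A \<rightarrow>\<^sub>E {..D})" using assms by (intro finite_PiE) auto
  have "card (A \<rightarrow>\<^sub>E {..D}) = (D + 1) ^ card A" using assms by (simp add: card_PiE)
  then show ?thesis
    using card_inj_on_le[OF inj sub fin] finite_imageD[OF finite_subset[OF sub fin] inj] by simp
qed

text \<open>
  The products of powers with exponents below \<open>N\<close> outnumber, for large \<open>N\<close>, the monomials in the
  variables from \<open>A\<close> that can occur in them.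
\<close>
lemma algebraic_dependence:
  fixes fs :: "'k::field mpoly list"
  assumes A: "finite A" and less: "card A < length fs"
  shows "\<exists>\<Lambda> c. finite \<Lambda> \<and> (\<forall>\<alpha>\<in>\<Lambda>. length \<alpha> = length fs) \<and> (\<exists>\<alpha>\<in>\<Lambda>. c \<alpha> \<noteq> 0) \<and>
    (\<forall>m\<in>Poly_Mapping.keys (\<Sum>\<alpha>\<in>\<Lambda>. const (c \<alpha>) * list_monomial fs \<alpha>). \<not> Poly_Mapping.keys m \<subseteq> A)"
proof -
  obtain d where d: "\<forall>f\<in>set fs. exponents_le d f" using exponents_le_list_exists by blast
  let ?r = "length fs"
  \<comment> \<open>With r the length of \<open>fs\<close>, the exponents that occur are at most D =
    r N d, and D + 1 <= N (r d + 1). Any N above (r d + 1) ^ |A| therefore makes (D + 1) ^ |A|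
    smaller than N ^ (|A| + 1) <= N ^ r, the number of exponent lists.\<close>
  define N where "N = (?r * d + 1) ^ card A + 1"
  define D where "D = ?r * (N * d)"
  define B where "B = {m. Poly_Mapping.keys m \<subseteq> A \<and> (\<forall>v. Poly_Mapping.lookup m v \<le> D)}"
  define \<Lambda> where "\<Lambda> = {\<alpha>. set \<alpha> \<subseteq> {..<N} \<and> length \<alpha> = ?r}"
  have fin: "finite \<Lambda>" by (simp add: \<Lambda>_def finite_lists_length_eq)
  have N: "0 < N" "(?r * d + 1) ^ card A < N" by (simp_all add: N_def)
  have "D + 1 \<le> N * (?r * d + 1)" using N(1) by (simp add: D_def)
  then have "(D + 1) ^ card A \<le> (N * (?r * d + 1)) ^ card A" by (intro power_mono) auto
  also have "\<dots> = N ^ card A * (?r * d + 1) ^ card A" by (rule power_mult_distrib)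
  also have "\<dots> < N ^ card A * N" using N by (intro mult_strict_left_mono) auto
  also have "\<dots> = N ^ Suc (card A)" by simp
  also have "\<dots> \<le> N ^ ?r" using less N(1) by (intro power_increasing) auto
  finally have "(D + 1) ^ card A < card \<Lambda>" by (simp add: \<Lambda>_def card_lists_length_eq)
  then have B: "finite B" "card B < card \<Lambda>"
    using card_bounded_monomials[OF A, of D] by (auto simp: B_def)
  \<comment> \<open>The unknowns are the coefficients of the relation. Only monomials in the
    variables from A impose equations, so the dependence holds modulo the remaining
    variables.\<close>
  obtain c where c: "\<exists>\<alpha>\<in>\<Lambda>. c \<alpha> \<noteq> 0"
    "\<forall>m\<in>B. (\<Sum>\<alpha>\<in>\<Lambda>. c \<alpha> * Poly_Mapping.lookup (list_monomial fs \<alpha>) m) = 0"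
    using homogeneous_system_nontrivial_solution[OF B(1) fin B(2),
        of "\<lambda>\<alpha>. Poly_Mapping.lookup (list_monomial fs \<alpha>)"] by blast
  let ?S = "\<Sum>\<alpha>\<in>\<Lambda>. const (c \<alpha>) * list_monomial fs \<alpha>"
  have lookup: "Poly_Mapping.lookup ?S m = (\<Sum>\<alpha>\<in>\<Lambda>. c \<alpha> * Poly_Mapping.lookup (list_monomial fs \<alpha>) m)" for m
    by (simp add: lookup_sum lookup_const_mult)
  have "\<not> Poly_Mapping.keys m \<subseteq> A" if m: "m \<in> Poly_Mapping.keys ?S" for m
  proof
    assume mA: "Poly_Mapping.keys m \<subseteq> A"
    have nz: "(\<Sum>\<alpha>\<in>\<Lambda>. c \<alpha> * Poly_Mapping.lookup (list_monomial fs \<alpha>) m) \<noteq> 0"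
      using m lookup[of m] by (simp add: in_keys_iff)
    obtain \<alpha> where "\<alpha> \<in> \<Lambda>" "c \<alpha> * Poly_Mapping.lookup (list_monomial fs \<alpha>) m \<noteq> 0"
      using nz by (rule sum.not_neutral_contains_not_neutral)
    then have \<alpha>: "\<alpha> \<in> \<Lambda>" "Poly_Mapping.lookup (list_monomial fs \<alpha>) m \<noteq> 0" by auto
    have "exponents_le D (list_monomial fs \<alpha>)"
      unfolding D_def using d \<alpha>(1) by (intro exponents_le_list_monomial) (auto simp: \<Lambda>_def)
    then have "m \<in> B" using \<alpha>(2) mA by (auto simp: exponents_le_def B_def in_keys_iff)
    then show False using c(2) nz by blast
  qed
  moreover have "\<forall>\<alpha>\<in>\<Lambda>. length \<alpha> = ?r" by (simp add: \<Lambda>_def)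
  ultimately show ?thesis using fin c(1) by blast
qed

section \<open>The polynomial ring as an abstract ring\<close>

lemma mpoly_ring_simps [simp]:
  "carrier (mpoly_ring n) = polys {1..n}"
  "mult (mpoly_ring n) = (*)" "one (mpoly_ring n) = 1"
  "zero (mpoly_ring n) = 0" "add (mpoly_ring n) = (+)"
  by (simp_all add: mpoly_ring_def polys_def)

lemma cring_mpoly_ring: "cring (mpoly_ring n)"
proof (rule cringI)
  show "abelian_group (mpoly_ring n)"
  proof (rule abelian_groupI)
    fix x :: "'k::field mpoly" assume "x \<in> carrier (mpoly_ring n)"
    then show "\<exists>y\<in>carrier (mpoly_ring n). y \<oplus>\<^bsub>mpoly_ring n\<^esub> x = \<zero>\<^bsub>mpoly_ring n\<^esub>"
      using P.uminus_closed by (intro bexI[of _ "- x"]) auto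
  qed (auto intro: P.add_closed P.zero_closed simp: add.assoc add.commute)
  show "comm_monoid (mpoly_ring n)"
    by (rule comm_monoidI) (auto intro: P.mult_closed P.one_closed simp: mult.assoc mult.commute)
qed (auto simp: distrib_right)

lemma ring_mpoly_ring: "ring (mpoly_ring n)"
  using cring_mpoly_ring by (rule cring.axioms)

lemma a_inv_mpoly_ring: "x \<in> polys {1..n} \<Longrightarrow> \<ominus>\<^bsub>mpoly_ring n\<^esub> x = - x"
proof -
  assume x: "x \<in> polys {1..n}"
  interpret R: ring "mpoly_ring n" by (rule ring_mpoly_ring)
  show ?thesis using R.minus_equality[of "- x" x] x P.uminus_closed[of x] by simp
qed

lemma ideal_mpoly_ring_iff: "ideal J (mpoly_ring n) \<longleftrightarrow> P.is_ideal {1..n} J"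
proof
  assume "ideal J (mpoly_ring n)"
  then interpret J: ideal J "mpoly_ring n" .
  show "P.is_ideal {1..n} J"
    using J.a_subset additive_subgroup.zero_closed[OF J.is_additive_subgroup]
      additive_subgroup.a_closed[OF J.is_additive_subgroup] J.I_l_closed
    by (intro P.is_idealI) auto
next
  assume J: "P.is_ideal {1..n} J"
  show "ideal J (mpoly_ring n)"
  proof (rule idealI[OF ring_mpoly_ring])
    show "subgroup J (add_monoid (mpoly_ring n))"
    proof (rule subgroup.intro)
      fix x assume "x \<in> J"
      then show "inv\<^bsub>add_monoid (mpoly_ring n)\<^esub> x \<in> J"
        using P.ideal_uminus[OF J] P.ideal_sub[OF J] a_inv_mpoly_ring[of x n]
        unfolding a_inv_def by metis
    qed (use P.ideal_sub[OF J] P.ideal_zero[OF J] P.ideal_add[OF J] in auto)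
  qed (use P.ideal_mult[OF J] P.ideal_mult_right[OF J] in auto)
qed

lemma genideal_is_ideal: "S \<subseteq> polys {1..n} \<Longrightarrow> P.is_ideal {1..n} (Idl\<^bsub>mpoly_ring n\<^esub> S)"
  using ring.genideal_ideal[OF ring_mpoly_ring, of S n] by (simp add: ideal_mpoly_ring_iff)

lemma genideal_subset: "S \<subseteq> polys {1..n} \<Longrightarrow> S \<subseteq> Idl\<^bsub>mpoly_ring n\<^esub> S"
  using ring.genideal_self[OF ring_mpoly_ring, of S n] by simp

lemma genideal_least: "P.is_ideal {1..n} J \<Longrightarrow> S \<subseteq> J \<Longrightarrow> Idl\<^bsub>mpoly_ring n\<^esub> S \<subseteq> J"
  using ring.genideal_minimal[OF ring_mpoly_ring, of J n S] by (simp add: ideal_mpoly_ring_iff)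


section \<open>Chains of primes in a quotient ring\<close>

text \<open>Preimages and images under the projection match the primes of the quotient with the
  primes above I. Whole chains are treated because \<open>krull_dim\<close> is a supremum over
  chains.\<close>

lemma (in cring) quotient_prime_chain_iff:
  assumes I: "ideal I R"
  shows "(\<exists>P :: nat \<Rightarrow> 'a set set. (\<forall>i\<le>m. primeideal (P i) (R Quot I)) \<and> (\<forall>i<m. P i \<subset> P (Suc i))) \<longleftrightarrow>
    (\<exists>P :: nat \<Rightarrow> 'a set. (\<forall>i\<le>m. primeideal (P i) R \<and> I \<subseteq> P i) \<and> (\<forall>i<m. P i \<subset> P (Suc i)))"
    (is "?L \<longleftrightarrow> ?R")
proof
  have carr: "carrier (R Quot I) = (+>) I ` carrier R"
    unfolding FactRing_def A_RCOSETS_def' by auto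
  have zero: "\<zero>\<^bsub>R Quot I\<^esub> = I" by (simp add: FactRing_def)
  interpret I: ideal I R by (rule I)
  interpret h: ring_hom_cring R "R Quot I" "(+>) I" by (rule I.rcos_ring_hom_cring[OF is_cring])
  {
    assume ?L
    then obtain P where P: "\<forall>i\<le>m. primeideal (P i) (R Quot I)" "\<forall>i<m. P i \<subset> P (Suc i)" by blast
    define Q where "Q i = {r \<in> carrier R. I +> r \<in> P i}" for i
    have prime: "primeideal (Q i) R \<and> I \<subseteq> Q i" if i: "i \<le> m" for i
    proof
      interpret P: primeideal "P i" "R Quot I" using P i by blast
      show "I \<subseteq> Q i"
        using I.a_subset a_rcos_zero[OF I] P.zero_closed by (auto simp: Q_def zero)
      show "primeideal (Q i) R"
      proof (rule primeidealI)
        show "ideal (Q i) R" unfolding Q_def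
          using ring_hom_ring.ideal_vimage[OF I.rcos_ring_hom_ring P.ideal_axioms] .
        show "carrier R \<noteq> Q i"
        proof
          assume "carrier R = Q i"
          then have "carrier (R Quot I) = P i" using carr P.a_subset by (auto simp: Q_def)
          then show False using P.I_notcarr by blast
        qed
        show "a \<in> Q i \<or> b \<in> Q i" if "a \<in> carrier R" "b \<in> carrier R" "a \<otimes> b \<in> Q i" for a b
          using that P.I_prime[of "I +> a" "I +> b"] by (auto simp: Q_def)
      qed (rule is_cring)
    qed
    have "Q i \<subset> Q (Suc i)" if i: "i < m" for i
    proof -
      have "P i \<subset> P (Suc i)" using P(2) i by blast
      then obtain X where X: "X \<in> P (Suc i)" "X \<notin> P i" by blast
      interpret P': primeideal "P (Suc i)" "R Quot I" using P i by simp
      obtain r where "r \<in> carrier R" "X = I +> r" using P'.a_subset X carr by blast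
      then show ?thesis using X \<open>P i \<subset> P (Suc i)\<close> by (auto simp: Q_def)
    qed
    then show ?R using prime by blast
  }
  {
    assume ?R
    then obtain P where P: "\<forall>i\<le>m. primeideal (P i) R \<and> I \<subseteq> P i" "\<forall>i<m. P i \<subset> P (Suc i)" by blast
    define Q where "Q i = (+>) I ` P i" for i
    \<comment> \<open>As I lies in \<open>P i\<close>, membership of a coset does not depend on the
      representative; properness, primality and strictness of the images all reduce to this.\<close>
    have mem: "I +> a \<in> Q i \<longleftrightarrow> a \<in> P i" if "i \<le> m" "a \<in> carrier R" for i a
    proof -
      interpret P: primeideal "P i" R using P that by blast
      show ?thesis
      proof
        assume "I +> a \<in> Q i"
        then obtain b where b: "b \<in> P i" "I +> a = I +> b" by (auto simp: Q_def)
        then have "a \<ominus> b \<in> I" using quotient_eq_iff_same_a_r_cos[OF I that(2)] P.a_subset by auto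
        then have "a \<ominus> b \<oplus> b \<in> P i" using P that b by blast
        moreover have "a \<ominus> b \<oplus> b = a" using that b P.Icarr by algebra
        ultimately show "a \<in> P i" by simp
      qed (auto simp: Q_def)
    qed
    have prime: "primeideal (Q i) (R Quot I)" if i: "i \<le> m" for i
    proof -
      interpret P: primeideal "P i" R using P i by blast
      show ?thesis
      proof (rule primeidealI)
        show "ideal (Q i) (R Quot I)" unfolding Q_def
          by (rule ring_ideal_imp_quot_ideal[OF I P.ideal_axioms])
        show "cring (R Quot I)" by (rule I.quotient_is_cring[OF is_cring])
        show "carrier (R Quot I) \<noteq> Q i"
          using P.I_notcarr P.a_subset mem[OF i] unfolding carr by blast
        fix a b assume ab: "a \<in> carrier (R Quot I)" "b \<in> carrier (R Quot I)" "a \<otimes>\<^bsub>R Quot I\<^esub> b \<in> Q i"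
        then obtain a' b' where a': "a' \<in> carrier R" "b' \<in> carrier R" "a = I +> a'" "b = I +> b'"
          unfolding carr by blast
        then have "I +> (a' \<otimes> b') \<in> Q i" using ab by simp
        then have "a' \<otimes> b' \<in> P i" using mem[OF i, of "a' \<otimes> b'"] a' by blast
        then show "a \<in> Q i \<or> b \<in> Q i" using mem[OF i] a' P.I_prime by blast
      qed
    qed
    have "Q i \<subset> Q (Suc i)" if i: "i < m" for i
    proof -
      have sub: "P i \<subset> P (Suc i)" using P(2) i by blast
      then obtain x where x: "x \<in> P (Suc i)" "x \<notin> P i" by blast
      interpret P': primeideal "P (Suc i)" R using P i by simp
      have "I +> x \<in> Q (Suc i)" "I +> x \<notin> Q i" using x mem[of i x] i P'.a_subset by (auto simp: Q_def)
      moreover have "Q i \<subseteq> Q (Suc i)" using sub by (auto simp: Q_def)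
      ultimately show ?thesis by blast
    qed
    then show ?L using prime by blast
  }
qed


section \<open>Depth of a cyclic module\<close>

lemma quotient_module_simps [simp]:
  "carrier (quotient_module R I) = carrier (R Quot I)"
  "add (quotient_module R I) = add (R Quot I)"
  "zero (quotient_module R I) = zero (R Quot I)"
  "a \<odot>\<^bsub>quotient_module R I\<^esub> X = (I +>\<^bsub>R\<^esub> a) \<otimes>\<^bsub>R Quot I\<^esub> X"
  by (simp_all add: quotient_module_def ring.defs module.defs)

lemma subgroup_quotient_module_iff:
  "subgroup N (add_monoid (quotient_module R I)) \<longleftrightarrow> subgroup N (add_monoid (R Quot I))"
  by (simp add: subgroup_def m_inv_def)

context
  fixes n :: nat and I :: "'k::field mpoly set"
  assumes I: "P.is_ideal {1..n} I"
begin

private abbreviation (input) "S \<equiv> mpoly_ring n :: 'k mpoly ring"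
private abbreviation (input) "M \<equiv> quotient_module (mpoly_ring n) I"

lemma ideal_I: "ideal I S"
  using I by (simp add: ideal_mpoly_ring_iff)

lemma coset_eq_iff:
  "a \<in> polys {1..n} \<Longrightarrow> b \<in> polys {1..n} \<Longrightarrow> I +>\<^bsub>S\<^esub> a = I +>\<^bsub>S\<^esub> b \<longleftrightarrow> a - b \<in> I"
  using ring.quotient_eq_iff_same_a_r_cos[OF ring_mpoly_ring ideal_I, of a b] a_inv_mpoly_ring[of b n]
  by (simp add: a_minus_def)

lemma carrier_quotient: "carrier (S Quot I) = (+>\<^bsub>S\<^esub>) I ` polys {1..n}"
  by (auto simp: FactRing_def A_RCOSETS_def')

lemma quotient_add: "a \<in> polys {1..n} \<Longrightarrow> b \<in> polys {1..n} \<Longrightarrow>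
    (I +>\<^bsub>S\<^esub> a) \<oplus>\<^bsub>S Quot I\<^esub> (I +>\<^bsub>S\<^esub> b) = I +>\<^bsub>S\<^esub> (a + b)"
  using ideal.a_rcos_sum[OF ideal_I, of a b] by (simp add: FactRing_def)

lemma quotient_mult: "a \<in> polys {1..n} \<Longrightarrow> b \<in> polys {1..n} \<Longrightarrow>
    (I +>\<^bsub>S\<^esub> a) \<otimes>\<^bsub>S Quot I\<^esub> (I +>\<^bsub>S\<^esub> b) = I +>\<^bsub>S\<^esub> (a * b)"
  using ideal.rcoset_mult_add[OF ideal_I, of a b] by (simp add: FactRing_def)

lemma quotient_zero: "\<zero>\<^bsub>S Quot I\<^esub> = I +>\<^bsub>S\<^esub> 0"
  using ring.a_rcos_zero[OF ring_mpoly_ring ideal_I, of 0] P.ideal_zero[OF I] by (simp add: FactRing_def)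

text \<open>The cosets of members of the extended ideal form a submodule that contains all the
  products. Conversely, the preimage of any such submodule is an ideal that contains I and also
  \<open>fs\<close>, since f times the class of 1 is the class of f.\<close>

lemma ideal_smult_quotient_iff:
  assumes fs: "set fs \<subseteq> polys {1..n}" and a: "a \<in> polys {1..n}"
  shows "I +>\<^bsub>S\<^esub> a \<in> ideal_smult S (Idl\<^bsub>S\<^esub> (set fs)) M \<longleftrightarrow>
    a \<in> foldl (P.extend {1..n}) I fs" (is "_ \<longleftrightarrow> a \<in> ?J")
proof
  have J: "P.is_ideal {1..n} ?J" "I \<subseteq> ?J" "set fs \<subseteq> ?J"
    using P.foldl_extend_ideal[OF I fs] P.foldl_extend_subset P.foldl_extend_generators[OF I fs] by auto
  let ?N = "(+>\<^bsub>S\<^esub>) I ` ?J"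
  have mem: "I +>\<^bsub>S\<^esub> b \<in> ?N \<longleftrightarrow> b \<in> ?J" if "b \<in> polys {1..n}" for b
  proof
    assume "I +>\<^bsub>S\<^esub> b \<in> ?N"
    then obtain c where "c \<in> ?J" "I +>\<^bsub>S\<^esub> b = I +>\<^bsub>S\<^esub> c" by blast
    then show "b \<in> ?J"
      using coset_eq_iff[OF that, of c] P.ideal_sub[OF J(1)] P.ideal_cong[OF J(1), of b c] J(2) by auto
  qed auto
  have "submodule ?N S M"
  proof (rule submodule.intro)
    interpret Q: ring "S Quot I" by (rule ideal.quotient_is_ring[OF ideal_I])
    have "ideal ?N (S Quot I)"
      using ring.ring_ideal_imp_quot_ideal[OF ring_mpoly_ring ideal_I] J(1) by (simp add: ideal_mpoly_ring_iff)
    then interpret N: ideal ?N "S Quot I" .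
    show "subgroup ?N (add_monoid M)" unfolding subgroup_quotient_module_iff by (rule N.a_subgroup)
    show "submodule_axioms ?N S M"
      using P.ideal_mult[OF J(1)] P.ideal_sub[OF J(1)]
      by (intro submodule_axioms.intro) (auto simp: quotient_mult)
  qed
  moreover have "{b \<odot>\<^bsub>M\<^esub> X | b X. b \<in> Idl\<^bsub>S\<^esub> (set fs) \<and> X \<in> carrier M} \<subseteq> ?N"
  proof -
    have "Idl\<^bsub>S\<^esub> (set fs) \<subseteq> ?J" using genideal_least J by blast
    then show ?thesis
      using P.ideal_mult_right[OF J(1)] P.ideal_sub[OF J(1)]
      by (fastforce simp: carrier_quotient quotient_mult)
  qed
  ultimately have "ideal_smult S (Idl\<^bsub>S\<^esub> (set fs)) M \<subseteq> ?N" by (auto simp: ideal_smult_def)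
  then show "I +>\<^bsub>S\<^esub> a \<in> ideal_smult S (Idl\<^bsub>S\<^esub> (set fs)) M \<Longrightarrow> a \<in> ?J"
    using mem[OF a] by blast
  assume aJ: "a \<in> ?J"
  have "I +>\<^bsub>S\<^esub> a \<in> N"
    if N: "submodule N S M" "{b \<odot>\<^bsub>M\<^esub> X | b X. b \<in> Idl\<^bsub>S\<^esub> (set fs) \<and> X \<in> carrier M} \<subseteq> N" for N
  proof -
    interpret N: submodule N S M by (rule N)
    define K where "K = {b \<in> polys {1..n}. I +>\<^bsub>S\<^esub> b \<in> N}"
    have "P.is_ideal {1..n} K"
    proof (rule P.is_idealI)
      show "0 \<in> K" using N.one_closed by (simp add: K_def quotient_zero P.zero_closed)
    next
      fix x y assume "x \<in> K" "y \<in> K"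
      then show "x + y \<in> K" using N.m_closed[of "I +>\<^bsub>S\<^esub> x" "I +>\<^bsub>S\<^esub> y"]
        by (simp add: K_def quotient_add P.add_closed)
    next
      fix r x :: "'k mpoly" assume "r \<in> polys {1..n}" "x \<in> K"
      then show "r * x \<in> K" using N.smult_closed[of r "I +>\<^bsub>S\<^esub> x"]
        by (simp add: K_def quotient_mult P.mult_closed)
    qed (simp add: K_def)
    moreover have "I \<subseteq> K"
    proof
      fix x assume x: "x \<in> I"
      then have "I +>\<^bsub>S\<^esub> x = I +>\<^bsub>S\<^esub> 0" using coset_eq_iff[of x 0] P.ideal_sub[OF I] by (simp add: P.zero_closed)
      then show "x \<in> K" using N.one_closed P.ideal_sub[OF I x] by (simp add: K_def quotient_zero)
    qed
    moreover have "set fs \<subseteq> K"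
    proof
      fix f assume f: "f \<in> set fs"
      then have "f \<in> Idl\<^bsub>S\<^esub> (set fs)" using genideal_subset[OF fs] by blast
      moreover have "I +>\<^bsub>S\<^esub> 1 \<in> carrier M" by (simp add: carrier_quotient P.one_closed)
      ultimately have "f \<odot>\<^bsub>M\<^esub> (I +>\<^bsub>S\<^esub> 1) \<in> N" using N(2) by blast
      moreover have "f \<in> polys {1..n}" using f fs by blast
      ultimately show "f \<in> K" using quotient_mult[of f 1] by (simp add: K_def P.one_closed)
    qed
    ultimately have "?J \<subseteq> K" by (rule P.foldl_extend_least)
    then show ?thesis using aJ by (auto simp: K_def)
  qed
  then show "I +>\<^bsub>S\<^esub> a \<in> ideal_smult S (Idl\<^bsub>S\<^esub> (set fs)) M" unfolding ideal_smult_def by blast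
qed

text \<open>Regularity on the quotient module becomes a matter of ideals in the polynomial ring; the
  submodule is everything exactly when it contains the class of 1.\<close>

lemma regular_sequence_quotient_iff:
  "regular_sequence S M fs \<longleftrightarrow> set fs \<subseteq> polys {1..n} \<and> P.weakly_regular {1..n} I fs \<and>
    1 \<notin> foldl (P.extend {1..n}) I fs"
proof (cases "set fs \<subseteq> polys {1..n}")
  case True
  let ?J = "\<lambda>i. ideal_smult S (Idl\<^bsub>S\<^esub> (set (take i fs))) M"
  let ?K = "\<lambda>i. foldl (P.extend {1..n}) I (take i fs)"
  have fs: "set (take i fs) \<subseteq> polys {1..n}" for i
    by (rule order_trans[OF set_take_subset True])
  have "(\<forall>X\<in>carrier M. (fs ! i) \<odot>\<^bsub>M\<^esub> X \<in> ?J i \<longrightarrow> X \<in> ?J i) \<longleftrightarrow> P.nzd {1..n} (fs ! i) (?K i)"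
    if "i < length fs" for i
  proof -
    have fi: "fs ! i \<in> polys {1..n}" using True that by auto
    have "(fs ! i) \<odot>\<^bsub>M\<^esub> (I +>\<^bsub>S\<^esub> x) \<in> ?J i \<longleftrightarrow> fs ! i * x \<in> ?K i" if x: "x \<in> polys {1..n}" for x
      unfolding quotient_module_simps quotient_mult[OF fi x]
      by (rule ideal_smult_quotient_iff[OF fs P.mult_closed[OF fi x]])
    then show ?thesis
      unfolding P.nzd_def quotient_module_simps(1) carrier_quotient ball_simps
      using ideal_smult_quotient_iff[OF fs] by (metis (no_types, lifting))
  qed
  moreover have "ideal_smult S (Idl\<^bsub>S\<^esub> (set fs)) M \<noteq> carrier M \<longleftrightarrow> 1 \<notin> foldl (P.extend {1..n}) I fs"
  proof -
    have J: "P.is_ideal {1..n} (foldl (P.extend {1..n}) I fs)" using P.foldl_extend_ideal[OF I True] .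
    have ideal_M: "submodule (carrier M) S M"
    proof -
      interpret Q: ring "S Quot I" by (rule ideal.quotient_is_ring[OF ideal_I])
      have "subgroup (carrier M) (add_monoid M)"
        unfolding subgroup_quotient_module_iff using Q.add.subgroup_self by simp
      then show ?thesis
        by (intro submodule.intro submodule_axioms.intro)
          (auto simp: carrier_quotient quotient_mult intro: P.mult_closed)
    qed
    have sub: "ideal_smult S (Idl\<^bsub>S\<^esub> (set fs)) M \<subseteq> carrier M"
      unfolding ideal_smult_def
    proof (rule Inter_lower, safe)
      show "submodule (carrier M) S M" by (rule ideal_M)
      fix b X assume "b \<in> Idl\<^bsub>S\<^esub> (set fs)" "X \<in> carrier M"
      then show "b \<odot>\<^bsub>M\<^esub> X \<in> carrier M"
        using P.ideal_sub[OF genideal_is_ideal[OF True]]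
        by (auto simp: carrier_quotient quotient_mult intro!: imageI P.mult_closed)
    qed
    show ?thesis
    proof
      assume "ideal_smult S (Idl\<^bsub>S\<^esub> (set fs)) M \<noteq> carrier M"
      then obtain a where a: "a \<in> polys {1..n}" "I +>\<^bsub>S\<^esub> a \<notin> ideal_smult S (Idl\<^bsub>S\<^esub> (set fs)) M"
        using sub by (auto simp: carrier_quotient)
      then have "a * 1 \<notin> foldl (P.extend {1..n}) I fs" using ideal_smult_quotient_iff[OF True] by simp
      then show "1 \<notin> foldl (P.extend {1..n}) I fs" using P.ideal_mult[OF J a(1)] by blast
    next
      assume "1 \<notin> foldl (P.extend {1..n}) I fs"
      then have "I +>\<^bsub>S\<^esub> 1 \<notin> ideal_smult S (Idl\<^bsub>S\<^esub> (set fs)) M"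
        using ideal_smult_quotient_iff[OF True P.one_closed] by blast
      then show "ideal_smult S (Idl\<^bsub>S\<^esub> (set fs)) M \<noteq> carrier M"
        by (auto simp: carrier_quotient intro: P.one_closed)
    qed
  qed
  ultimately show ?thesis
    using True by (auto simp: regular_sequence_def P.weakly_regular_iff_nth)
qed (simp add: regular_sequence_def)

end

section \<open>Edge ideals as monomial ideals\<close>

definition independent :: "nat \<Rightarrow> nat set set \<Rightarrow> nat set \<Rightarrow> bool" where
  "independent n E A \<longleftrightarrow> A \<subseteq> {1..n} \<and> (\<forall>e\<in>E. \<not> e \<subseteq> A)"

text \<open>Maximality is put as domination, because the depth bound needs a neighbour in A for each
  vertex outside A.\<close>

definition maximal_independent :: "nat \<Rightarrow> nat set set \<Rightarrow> nat set \<Rightarrow> bool" where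
  "maximal_independent n E A \<longleftrightarrow> independent n E A \<and> (\<forall>v\<in>{1..n} - A. \<exists>a\<in>A. {v, a} \<in> E)"

lemma independent_finite: "independent n E A \<Longrightarrow> finite A"
  by (auto simp: independent_def intro: finite_subset)

lemma simple_graph_edgeE:
  assumes "simple_graph n E" "e \<in> E"
  obtains i j where "e = {i, j}" "i \<noteq> j" "i \<in> {1..n}" "j \<in> {1..n}"
  using assms unfolding simple_graph_def nsets_2_eq by blast

lemma mvar_mult_mvar:
  "mvar i * mvar j = Poly_Mapping.single (Poly_Mapping.single i 1 + Poly_Mapping.single j 1) 1"
  by (simp add: mvar_def mult_single)

lemma single_index_eq_iff: "Poly_Mapping.single i (Suc 0) = Poly_Mapping.single j (Suc 0) \<longleftrightarrow> i = j"
  by (metis keys_single nat.distinct(1) singleton_inject)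

lemma keys_mvar: "Poly_Mapping.keys (mvar i :: 'k::field mpoly) = {Poly_Mapping.single i 1}"
  by (simp add: mvar_def)

text \<open>A monomial whose support contains both ends of an edge is divisible by the generator of
  that edge. Membership thereby depends only on the supports of the single monomials.\<close>

lemma edge_ideal_eq:
  assumes G: "simple_graph n E"
  shows "edge_ideal n E = {f \<in> polys {1..n} :: 'k::field mpoly set. \<forall>m\<in>Poly_Mapping.keys f. \<exists>e\<in>E. e \<subseteq> Poly_Mapping.keys m}"
    (is "_ = ?I")
proof
  let ?S = "{mvar i * mvar j | i j. {i, j} \<in> E} :: 'k mpoly set"
  have S: "?S \<subseteq> polys {1..n}"
  proof safe
    fix i j assume "{i, j} \<in> E"
    then have "i \<in> {1..n}" "j \<in> {1..n}" using G unfolding simple_graph_def by auto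
    then show "mvar i * mvar j \<in> polys {1..n}" by (intro P.mult_closed mvar_polys)
  qed
  have "P.is_ideal {1..n} ?I"
    by (rule monomial_ideal) (auto simp: keys_plus_nat)
  moreover have "?S \<subseteq> ?I"
  proof
    fix f assume "f \<in> ?S"
    then obtain i j where f: "f = mvar i * mvar j" "{i, j} \<in> E" by blast
    have "Poly_Mapping.keys f = {Poly_Mapping.single i 1 + Poly_Mapping.single j 1}"
      by (simp add: f mvar_mult_mvar)
    then show "f \<in> ?I" using f(2) S \<open>f \<in> ?S\<close> by (auto simp: keys_plus_nat intro!: bexI[of _ "{i, j}"])
  qed
  ultimately show "edge_ideal n E \<subseteq> ?I" unfolding edge_ideal_def by (rule genideal_least)
  have J: "P.is_ideal {1..n} (edge_ideal n E :: 'k mpoly set)"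
    unfolding edge_ideal_def by (rule genideal_is_ideal[OF S])
  show "?I \<subseteq> (edge_ideal n E :: 'k mpoly set)"
  proof
    fix f :: "'k mpoly" assume f: "f \<in> ?I"
    have "(\<Sum>m\<in>Poly_Mapping.keys f. Poly_Mapping.single m (Poly_Mapping.lookup f m)) \<in> edge_ideal n E"
    proof (rule P.ideal_sum[OF J])
      fix m assume m: "m \<in> Poly_Mapping.keys f"
      then obtain e where e: "e \<in> E" "e \<subseteq> Poly_Mapping.keys m" using f by blast
      obtain i j where ij: "e = {i, j}" "i \<noteq> j" using simple_graph_edgeE[OF G e(1)] by metis
      \<comment> \<open>Subtraction of exponent vectors is truncated; nothing is lost, since i and j
        are distinct and both lie in the support of m.\<close>
      define m' where "m' = m - (Poly_Mapping.single i 1 + Poly_Mapping.single j 1)"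
      have "m = Poly_Mapping.single i 1 + Poly_Mapping.single j 1 + m'"
        using ij e(2)
        by (intro poly_mapping_eqI) (auto simp: m'_def lookup_add lookup_minus lookup_single when_def in_keys_iff)
      then have eq: "Poly_Mapping.single m (Poly_Mapping.lookup f m) =
          Poly_Mapping.single m' (Poly_Mapping.lookup f m) * (mvar i * mvar j)"
        by (simp add: mvar_mult_mvar mult_single add.commute)
      have "Poly_Mapping.keys m' \<subseteq> Poly_Mapping.keys m"
        by (auto simp: m'_def in_keys_iff lookup_minus)
      also have "\<dots> \<subseteq> {1..n}" using f m by (auto simp: polys_def)
      finally have "Poly_Mapping.single m' (Poly_Mapping.lookup f m) \<in> polys {1..n}" by (rule single_polys)
      moreover have "mvar i * mvar j \<in> (edge_ideal n E :: 'k mpoly set)"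
        using genideal_subset[OF S] e(1) ij(1) by (auto simp: edge_ideal_def)
      ultimately show "Poly_Mapping.single m (Poly_Mapping.lookup f m) \<in> edge_ideal n E"
        unfolding eq by (rule P.ideal_mult[OF J])
    qed
    then show "f \<in> edge_ideal n E" using poly_eq_sum_singles[of f] by simp
  qed
qed

lemma edge_ideal_is_ideal: "simple_graph n E \<Longrightarrow> P.is_ideal {1..n} (edge_ideal n E)"
  unfolding edge_ideal_eq by (rule monomial_ideal) (auto simp: keys_plus_nat)

section \<open>Face ideals\<close>

definition face_subst :: "nat set \<Rightarrow> nat \<Rightarrow> 'k::field mpoly" where
  "face_subst A v = (if v \<in> A then mvar v else 0)"

text \<open>The prime generated by the variables of V outside A, described through its monomials.
  The name refers to the independence complex, whose faces are the independent sets.\<close>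

definition face_ideal :: "nat set \<Rightarrow> nat set \<Rightarrow> 'k::field mpoly set" where
  "face_ideal V A = {f \<in> polys V. \<forall>m\<in>Poly_Mapping.keys f. \<not> Poly_Mapping.keys m \<subseteq> A}"

lemma monom_face_subst:
  "monom_subst (face_subst A) m = (if Poly_Mapping.keys m \<subseteq> A then Poly_Mapping.single m 1 else 0)"
proof (cases "Poly_Mapping.keys m \<subseteq> A")
  case True
  then have "monom_subst (face_subst A) m = monom_subst mvar m"
    unfolding monom_subst_def by (intro prod.cong) (auto simp: face_subst_def)
  then show ?thesis using True by (simp add: monom_subst_mvar)
next
  case False
  then obtain v where "v \<in> Poly_Mapping.keys m" "v \<notin> A" by blast
  then have "face_subst A v ^ Poly_Mapping.lookup m v = (0 :: 'a mpoly)"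
    by (simp add: face_subst_def in_keys_iff zero_power)
  then show ?thesis using False \<open>v \<in> Poly_Mapping.keys m\<close> by (auto simp: monom_subst_def intro: prod_zero)
qed

lemma lookup_face_subst:
  "Poly_Mapping.lookup (subst (face_subst A) f) m =
    (if Poly_Mapping.keys m \<subseteq> A then Poly_Mapping.lookup f m else 0)"
proof -
  have "Poly_Mapping.lookup (subst (face_subst A) f) m = (\<Sum>m'\<in>Poly_Mapping.keys f.
      if m' = m then (if Poly_Mapping.keys m \<subseteq> A then Poly_Mapping.lookup f m else 0) else 0)"
    unfolding subst_def lookup_sum lookup_const_mult
    by (intro sum.cong) (auto simp: monom_face_subst lookup_single when_def)
  then show ?thesis by (auto simp: in_keys_iff)
qed

lemma face_ideal_eq_subst_kernel: "face_ideal V A = subst_kernel V (face_subst A)"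
proof -
  have "subst (face_subst A) f = 0 \<longleftrightarrow> (\<forall>m\<in>Poly_Mapping.keys f. \<not> Poly_Mapping.keys m \<subseteq> A)"
    for f :: "'a mpoly"
    unfolding poly_mapping_eq_iff fun_eq_iff lookup_face_subst by (auto simp: in_keys_iff)
  then show ?thesis by (simp add: face_ideal_def subst_kernel_def)
qed

lemma face_ideal_is_ideal: "P.is_ideal V (face_ideal V A)"
  unfolding face_ideal_eq_subst_kernel by (rule subst_kernel_ideal)

lemma face_ideal_least:
  assumes J: "P.is_ideal V J" and vars: "\<And>v. v \<in> V - A \<Longrightarrow> mvar v \<in> J"
  shows "face_ideal V A \<subseteq> J"
proof
  fix f :: "'a mpoly" assume f: "f \<in> face_ideal V A"
  have "f - subst (face_subst A) f \<in> J"
    using f vars P.ideal_zero[OF J]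
    by (intro diff_subst_mem_ideal[OF J]) (auto simp: face_subst_def face_ideal_def mvar_polys P.zero_closed)
  then show "f \<in> J" using f by (simp add: face_ideal_eq_subst_kernel subst_kernel_def)
qed

lemma one_notin_face_ideal: "1 \<notin> face_ideal V A"
  by (simp add: face_ideal_def)

lemma mvar_mem_face_ideal_iff: "v \<in> V \<Longrightarrow> mvar v \<in> face_ideal V A \<longleftrightarrow> v \<notin> A"
  by (simp add: face_ideal_def mvar_polys keys_mvar)

lemma primeideal_face_ideal: "primeideal (face_ideal {1..n} A :: 'k::field mpoly set) (mpoly_ring n)"
proof (rule primeidealI)
  show "ideal (face_ideal {1..n} A :: 'k mpoly set) (mpoly_ring n)"
    by (simp only: ideal_mpoly_ring_iff face_ideal_is_ideal)
  show "carrier (mpoly_ring n) \<noteq> (face_ideal {1..n} A :: 'k mpoly set)"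
    using one_notin_face_ideal P.one_closed by (metis mpoly_ring_simps(1))
qed (use subst_kernel_prime in \<open>auto simp: face_ideal_eq_subst_kernel cring_mpoly_ring\<close>)

lemma edge_ideal_subset_face_ideal:
  "simple_graph n E \<Longrightarrow> independent n E A \<Longrightarrow> edge_ideal n E \<subseteq> face_ideal {1..n} A"
  by (auto simp: edge_ideal_eq face_ideal_def independent_def) (meson order_trans)

section \<open>Krull dimension of the edge ring\<close>

text \<open>An element of \<open>P (Suc i) - P i\<close> is a nonzerodivisor modulo the prime
  \<open>P i\<close>, so one element per step behaves like a regular sequence. Too many of them are
  dependent modulo the variables in \<open>P 0\<close>, hence modulo \<open>P 0\<close>, and
  \<open>relation_chain\<close> puts 1 into the top prime.\<close>

lemma prime_chain_length_le:
  fixes P :: "nat \<Rightarrow> 'k::field mpoly set"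
  assumes prime: "\<And>i. i \<le> m \<Longrightarrow> primeideal (P i) (mpoly_ring n)"
    and strict: "\<And>i. i < m \<Longrightarrow> P i \<subset> P (Suc i)"
  shows "m \<le> card {v \<in> {1..n}. mvar v \<notin> P 0}"
proof (rule ccontr)
  let ?A = "{v \<in> {1..n}. mvar v \<notin> P 0}"
  assume "\<not> m \<le> card ?A"
  have ideal: "P.is_ideal {1..n} (P i)" if "i \<le> m" for i
    using primeideal.axioms(1)[OF prime[OF that]] by (simp only: ideal_mpoly_ring_iff)
  have "\<exists>f. f \<in> P (Suc i) - P i" if "i < m" for i using strict[OF that] by blast
  then obtain f where f: "\<And>i. i < m \<Longrightarrow> f i \<in> P (Suc i) - P i" by metis
  let ?fs = "map f [0..<m]"
  have fR: "f i \<in> polys {1..n}" if "i < m" for i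
    using f[OF that] P.ideal_sub[OF ideal[of "Suc i"]] that by auto
  obtain \<Lambda> c where \<Lambda>: "finite \<Lambda>" "\<forall>\<alpha>\<in>\<Lambda>. length \<alpha> = length ?fs" "\<exists>\<alpha>\<in>\<Lambda>. c \<alpha> \<noteq> 0"
    and S: "\<forall>m\<in>Poly_Mapping.keys (\<Sum>\<alpha>\<in>\<Lambda>. const (c \<alpha>) * list_monomial ?fs \<alpha>). \<not> Poly_Mapping.keys m \<subseteq> ?A"
    using algebraic_dependence[of ?A ?fs] \<open>\<not> m \<le> card ?A\<close> by auto
  have fs: "set ?fs \<subseteq> polys {1..n}" using fR by auto
  have "(\<Sum>\<alpha>\<in>\<Lambda>. const (c \<alpha>) * list_monomial ?fs \<alpha>) \<in> polys {1..n}"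
    by (intro P.sum_closed P.mult_closed const_polys P.list_monomial_closed[OF fs])
  then have "(\<Sum>\<alpha>\<in>\<Lambda>. const (c \<alpha>) * list_monomial ?fs \<alpha>) \<in> face_ideal {1..n} ?A"
    unfolding face_ideal_def using S by blast
  moreover have "face_ideal {1..n} ?A \<subseteq> P 0"
    using ideal[of 0] by (intro face_ideal_least) auto
  ultimately have rel: "(\<Sum>\<alpha>\<in>\<Lambda>. const (c \<alpha>) * list_monomial ?fs \<alpha>) * 1 \<in> P 0" by auto
  have "1 \<in> P (length ?fs)"
  proof (rule P.relation_chain[where J = P and V = "{1..n}", OF _ _ _ fs P.one_closed \<Lambda>(1) _ _ _ rel])
    fix i assume i: "i < length ?fs"
    then have im: "i < m" by simp
    show "P.nzd {1..n} (?fs ! i) (P i)"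
      unfolding P.nzd_def
    proof (intro ballI impI)
      fix x assume "x \<in> polys {1..n}" "?fs ! i * x \<in> P i"
      then show "x \<in> P i"
        using primeideal.I_prime[OF prime[of i], of "f i" x] im f[OF im] fR[OF im] by auto
    qed
    show "P i \<subseteq> P (Suc i) \<and> ?fs ! i \<in> P (Suc i)"
      using im f[OF im] strict[OF im] by auto
  next
    show "\<exists>\<alpha>\<in>\<Lambda>. const (c \<alpha>) \<noteq> 0" using \<Lambda>(3) by (simp add: const_eq_0_iff)
    show "const (c \<alpha>) \<in> polys {1..n} \<and>
        (const (c \<alpha>) \<noteq> 0 \<longrightarrow> (\<exists>b\<in>polys {1..n}. b * const (c \<alpha>) = 1))" for \<alpha>
      using const_inverse const_polys by (auto simp: const_eq_0_iff)
  qed (use ideal \<Lambda>(2) in auto)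
  moreover have "1 \<notin> P m"
  proof
    assume "1 \<in> P m"
    then have "P m = carrier (mpoly_ring n)"
      using ideal.one_imp_carrier[OF primeideal.axioms(1)[OF prime[of m]]] by simp
    then show False using primeideal.I_notcarr[OF prime[of m]] by simp
  qed
  ultimately show False by simp
qed

text \<open>Deleting the vertices of A one by one adds one variable to the prime at each step; this
  chain attains the dimension.\<close>

lemma face_ideal_chain:
  assumes A: "finite A" "A \<subseteq> V"
  shows "\<exists>g. \<forall>i<card A. face_ideal V (A - g ` {..<i}) \<subset> (face_ideal V (A - g ` {..<Suc i}) :: 'k::field mpoly set)"
proof -
  obtain g where g: "bij_betw g {0..<card A} A" using ex_bij_betw_nat_finite[OF A(1)] by blast
  have "face_ideal V (A - g ` {..<i}) \<subset> (face_ideal V (A - g ` {..<Suc i}) :: 'k mpoly set)" if i: "i < card A" for i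
  proof
    have gi: "g i \<in> A" using g i by (auto simp: bij_betw_def)
    have "g i \<notin> g ` {..<i}"
    proof
      assume "g i \<in> g ` {..<i}"
      then obtain j where "j < i" "g i = g j" by blast
      then show False using g i inj_onD[of g "{0..<card A}" i j] by (auto simp: bij_betw_def)
    qed
    then have "mvar (g i) \<notin> (face_ideal V (A - g ` {..<i}) :: 'k mpoly set)"
      "mvar (g i) \<in> (face_ideal V (A - g ` {..<Suc i}) :: 'k mpoly set)"
      using gi A(2) by (auto simp: mvar_mem_face_ideal_iff)
    then show "face_ideal V (A - g ` {..<i}) \<noteq> (face_ideal V (A - g ` {..<Suc i}) :: 'k mpoly set)" by blast
    have "A - g ` {..<Suc i} \<subseteq> A - g ` {..<i}" by auto
    then show "face_ideal V (A - g ` {..<i}) \<subseteq> (face_ideal V (A - g ` {..<Suc i}) :: 'k mpoly set)"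
      unfolding face_ideal_def by blast
  qed
  then show ?thesis by blast
qed

lemma graph_dim_eq:
  assumes G: "simple_graph n E"
    and A: "independent n E A" and max: "\<And>B. independent n E B \<Longrightarrow> card B \<le> card A"
  shows "graph_dim TYPE('k::field) n E = enat (card A)"
proof -
  let ?I = "edge_ideal n E :: 'k mpoly set"
  have I: "ideal ?I (mpoly_ring n)"
    using edge_ideal_is_ideal[OF G] by (simp only: ideal_mpoly_ring_iff)
  define C where "C m \<longleftrightarrow> (\<exists>P :: nat \<Rightarrow> 'k mpoly set.
    (\<forall>i\<le>m. primeideal (P i) (mpoly_ring n) \<and> ?I \<subseteq> P i) \<and> (\<forall>i<m. P i \<subset> P (Suc i)))" for m
  have dim: "graph_dim TYPE('k) n E = Sup {enat m | m. C m}"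
    unfolding graph_dim_def krull_dim_def cring.quotient_prime_chain_iff[OF cring_mpoly_ring I] C_def ..
  have le: "m \<le> card A" if m: "C m" for m
  proof -
    obtain P :: "nat \<Rightarrow> 'k mpoly set" where P: "\<forall>i\<le>m. primeideal (P i) (mpoly_ring n) \<and> ?I \<subseteq> P i"
      "\<forall>i<m. P i \<subset> P (Suc i)" using m unfolding C_def by blast
    let ?B = "{v \<in> {1..n}. mvar v \<notin> P 0}"
    \<comment> \<open>A prime that contains the product of two adjacent variables contains one of
      them, so the variables it misses are pairwise non-adjacent.\<close>
    have "\<not> e \<subseteq> ?B" if "e \<in> E" for e
    proof -
      obtain i j where ij: "e = {i, j}" "i \<in> {1..n}" "j \<in> {1..n}" using simple_graph_edgeE[OF G \<open>e \<in> E\<close>] by metis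
      have "mvar i * mvar j \<in> ?I"
        unfolding edge_ideal_eq[OF G] using ij \<open>e \<in> E\<close>
        by (auto simp: mvar_mult_mvar keys_plus_nat intro!: single_polys bexI[of _ e])
      then have "mvar i * mvar j \<in> P 0" using P by auto
      then have "mvar i \<in> P 0 \<or> mvar j \<in> P 0"
        using primeideal.I_prime[of "P 0" "mpoly_ring n" "mvar i" "mvar j"] P ij by (simp add: mvar_polys)
      then show ?thesis using ij by auto
    qed
    then have "independent n E ?B" by (auto simp: independent_def)
    then have "card ?B \<le> card A" by (rule max)
    moreover have "m \<le> card ?B" using P by (intro prime_chain_length_le) auto
    ultimately show ?thesis by simp
  qed
  have "C (card A)"
  proof -
    have fin: "finite A" "A \<subseteq> {1..n}" using A independent_finite by (auto simp: independent_def)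
    obtain g where g: "\<forall>i<card A. face_ideal {1..n} (A - g ` {..<i}) \<subset>
        (face_ideal {1..n} (A - g ` {..<Suc i}) :: 'k mpoly set)"
      using face_ideal_chain[OF fin] by blast
    have "?I \<subseteq> face_ideal {1..n} (A - g ` {..<i})" for i
      using A by (intro edge_ideal_subset_face_ideal[OF G]) (auto simp: independent_def)
    then show ?thesis unfolding C_def using g primeideal_face_ideal
      by (intro exI[of _ "\<lambda>i. face_ideal {1..n} (A - g ` {..<i})"]) blast
  qed
  then have "enat (card A) \<in> {enat m | m. C m}" by blast
  moreover have "x \<le> enat (card A)" if x: "x \<in> {enat m | m. C m}" for x
  proof -
    obtain m where "x = enat m" "C m" using x by blast
    then show ?thesis using le[of m] by simp
  qed
  ultimately show ?thesis unfolding dim by (intro antisym Sup_least Sup_upper)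
qed

section \<open>Depth of the edge ring\<close>

lemma irrelevant_ideal_eq:
  "irrelevant_ideal n = {f \<in> polys {1..n} :: 'k::field mpoly set. \<forall>m\<in>Poly_Mapping.keys f. m \<noteq> 0}"
proof
  have S: "mvar ` {1..n} \<subseteq> (polys {1..n} :: 'k mpoly set)" by (auto intro: mvar_polys)
  have eq: "{f \<in> polys {1..n}. \<forall>m\<in>Poly_Mapping.keys f. m \<noteq> 0} = (face_ideal {1..n} {} :: 'k mpoly set)"
    by (simp add: face_ideal_def)
  show "irrelevant_ideal n \<subseteq> {f \<in> polys {1..n}. \<forall>m\<in>Poly_Mapping.keys (f :: 'k mpoly). m \<noteq> 0}"
    unfolding irrelevant_ideal_def eq
    by (intro genideal_least face_ideal_is_ideal) (auto simp: mvar_mem_face_ideal_iff)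
  show "{f \<in> polys {1..n}. \<forall>m\<in>Poly_Mapping.keys (f :: 'k mpoly). m \<noteq> 0} \<subseteq> irrelevant_ideal n"
    unfolding irrelevant_ideal_def eq
    by (intro face_ideal_least genideal_is_ideal S) (use genideal_subset[OF S] in auto)
qed

lemma irrelevant_ideal_eq_face_ideal: "irrelevant_ideal n = face_ideal {1..n} {}"
  by (simp add: irrelevant_ideal_eq face_ideal_def)

text \<open>Properness is automatic: the edge ideal and all of \<open>fs\<close> lie in the
  irrelevant ideal, which does not contain 1.\<close>

lemma graph_depth_ge:
  fixes fs :: "'k::field mpoly list"
  assumes G: "simple_graph n E" and fs: "set fs \<subseteq> irrelevant_ideal n"
    and reg: "P.weakly_regular {1..n} (edge_ideal n E) fs"
  shows "enat (length fs) \<le> graph_depth TYPE('k) n E"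
proof -
  let ?I = "edge_ideal n E :: 'k mpoly set" and ?m = "irrelevant_ideal n :: 'k mpoly set"
  have m: "P.is_ideal {1..n} ?m" unfolding irrelevant_ideal_eq_face_ideal by (rule face_ideal_is_ideal)
  have "independent n E {}" by (auto simp: independent_def elim: simple_graph_edgeE[OF G])
  then have "?I \<subseteq> ?m" unfolding irrelevant_ideal_eq_face_ideal by (rule edge_ideal_subset_face_ideal[OF G])
  then have "foldl (P.extend {1..n}) ?I fs \<subseteq> ?m" using fs by (intro P.foldl_extend_least m)
  then have "1 \<notin> foldl (P.extend {1..n}) ?I fs"
    using one_notin_face_ideal unfolding irrelevant_ideal_eq_face_ideal by blast
  moreover have "set fs \<subseteq> polys {1..n}" using fs P.ideal_sub[OF m] by blast
  ultimately have "regular_sequence (mpoly_ring n) (quotient_module (mpoly_ring n) ?I) fs"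
    using regular_sequence_quotient_iff[OF edge_ideal_is_ideal[OF G]] reg by blast
  then show ?thesis unfolding graph_depth_def module_depth_def using fs by (intro Sup_upper) blast
qed

text \<open>Each monomial of f involves a vertex outside A; maximality gives it a neighbour in A,
  whose variable divides u. Thus u is the witness that the face ideal of A is an associated
  prime.\<close>

lemma edge_ideal_mult_face_ideal:
  assumes G: "simple_graph n E" and A: "maximal_independent n E A"
    and f: "f \<in> face_ideal {1..n} A" and u: "u = Poly_Mapping.single m 1" "Poly_Mapping.keys m = A"
  shows "f * u \<in> edge_ideal n E"
proof -
  have "\<exists>e\<in>E. e \<subseteq> Poly_Mapping.keys b" if b: "b \<in> Poly_Mapping.keys (f * u)" for b
  proof -
    obtain a where a: "a \<in> Poly_Mapping.keys f" "b = a + m" using b u by (elim keys_multE) auto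
    then obtain v where v: "v \<in> Poly_Mapping.keys a" "v \<notin> A" "v \<in> {1..n}"
      using f by (force simp: face_ideal_def polys_def)
    then have "v \<in> {1..n} - A" by blast
    then obtain w where "w \<in> A" "{v, w} \<in> E" using A unfolding maximal_independent_def by blast
    then show ?thesis using v u(2) a(2) by (intro bexI[of _ "{v, w}"]) (auto simp: keys_plus_nat)
  qed
  moreover have "f * u \<in> polys {1..n}"
    using f u A unfolding face_ideal_def maximal_independent_def independent_def
    by (intro P.mult_closed single_polys) (auto simp: single_polys)
  ultimately show ?thesis by (simp add: edge_ideal_eq[OF G])
qed

text \<open>This is the bound of the depth by the dimension of R/P for an associated prime P, with P
  the face ideal of A; the explicit element u annihilated by P replaces homological
  arguments.\<close>

lemma regular_sequence_length_le:
  fixes fs :: "'k::field mpoly list"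
  assumes G: "simple_graph n E" and A: "maximal_independent n E A"
    and fs: "set fs \<subseteq> irrelevant_ideal n" and reg: "P.weakly_regular {1..n} (edge_ideal n E) fs"
  shows "length fs \<le> card A"
proof (rule ccontr)
  assume less: "\<not> length fs \<le> card A"
  let ?I = "edge_ideal n E :: 'k mpoly set"
  have indep: "independent n E A" "A \<subseteq> {1..n}" "finite A"
    using A independent_finite by (auto simp: maximal_independent_def independent_def)
  note I = edge_ideal_is_ideal[OF G, where ?'a = 'k]
  have fsR: "set fs \<subseteq> polys {1..n}" using fs by (auto simp: irrelevant_ideal_eq)
  \<comment> \<open>The element u will have degree |A|; the exponent |A| + 1 lifts every monomial of
    the powers above that degree.\<close>
  define gs where "gs = map (\<lambda>f. f ^ Suc (card A)) fs"
  have gsR: "set gs \<subseteq> polys {1..n}" using fsR P.power_closed unfolding gs_def by (auto simp del: power_Suc)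
  have gs: "P.weakly_regular {1..n} ?I gs"
    unfolding gs_def by (rule P.weakly_regular_powers[OF reg I fsR])
  define m where "m = (\<Sum>a\<in>A. Poly_Mapping.single a (1::nat))"
  have lookup_m: "Poly_Mapping.lookup m v = (if v \<in> A then 1 else 0)" for v
    using indep(3) by (simp add: m_def lookup_sum lookup_single when_def)
  have keys_m: "Poly_Mapping.keys m = A" by (auto simp: in_keys_iff lookup_m split: if_splits)
  define u where "u = (Poly_Mapping.single m 1 :: 'k mpoly)"
  have uR: "u \<in> polys {1..n}" unfolding u_def using keys_m indep by (intro single_polys) simp
  obtain \<Lambda> c where \<Lambda>: "finite \<Lambda>" "\<forall>\<alpha>\<in>\<Lambda>. length \<alpha> = length gs" "\<exists>\<alpha>\<in>\<Lambda>. c \<alpha> \<noteq> 0"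
    and S: "\<forall>m\<in>Poly_Mapping.keys (\<Sum>\<alpha>\<in>\<Lambda>. const (c \<alpha>) * list_monomial gs \<alpha>). \<not> Poly_Mapping.keys m \<subseteq> A"
    using algebraic_dependence[of A gs] less indep(3) by (auto simp: gs_def)
  have "(\<Sum>\<alpha>\<in>\<Lambda>. const (c \<alpha>) * list_monomial gs \<alpha>) \<in> polys {1..n}"
    by (intro P.sum_closed P.mult_closed const_polys P.list_monomial_closed[OF gsR])
  then have "(\<Sum>\<alpha>\<in>\<Lambda>. const (c \<alpha>) * list_monomial gs \<alpha>) \<in> face_ideal {1..n} A"
    unfolding face_ideal_def using S by blast
  then have "(\<Sum>\<alpha>\<in>\<Lambda>. const (c \<alpha>) * list_monomial gs \<alpha>) * u \<in> ?I"
    by (rule edge_ideal_mult_face_ideal[OF G A _ u_def keys_m])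
  then have rel: "(\<Sum>\<alpha>\<in>\<Lambda>. const (c \<alpha>) * list_monomial gs \<alpha>) * u \<in> foldl (P.extend {1..n}) ?I (take 0 gs)"
    by simp
  let ?J = "\<lambda>i. foldl (P.extend {1..n}) ?I (take i gs)"
  have take: "set (take i gs) \<subseteq> polys {1..n}" for i by (rule order_trans[OF set_take_subset gsR])
  have "u \<in> ?J (length gs)"
  proof (rule P.relation_chain[where J = ?J and V = "{1..n}", OF _ _ _ gsR uR \<Lambda>(1) _ _ _ rel])
    fix i assume i: "i < length gs"
    then show "P.nzd {1..n} (gs ! i) (?J i)" using gs by (simp add: P.weakly_regular_iff_nth)
    have "?J (Suc i) = P.extend {1..n} (?J i) (gs ! i)" using i by (simp add: take_Suc_conv_app_nth)
    then show "?J i \<subseteq> ?J (Suc i) \<and> gs ! i \<in> ?J (Suc i)"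
      using P.extend_subset P.extend_generator[OF P.foldl_extend_ideal[OF I take]] by metis
  next
    show "P.is_ideal {1..n} (?J i)" for i by (rule P.foldl_extend_ideal[OF I take])
    show "\<exists>\<alpha>\<in>\<Lambda>. const (c \<alpha>) \<noteq> 0" using \<Lambda>(3) by (simp add: const_eq_0_iff)
    show "const (c \<alpha>) \<in> polys {1..n} \<and>
        (const (c \<alpha>) \<noteq> 0 \<longrightarrow> (\<exists>b\<in>polys {1..n}. b * const (c \<alpha>) = 1))" for \<alpha>
      using const_inverse const_polys by (auto simp: const_eq_0_iff)
  qed (use \<Lambda>(2) in auto)
  then have u_mem: "u \<in> foldl (P.extend {1..n}) ?I gs" by simp
  define deg where "deg m = (\<Sum>v\<in>{1..n}. Poly_Mapping.lookup m v)" for m :: "nat \<Rightarrow>\<^sub>0 nat"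
  have deg_add: "deg (a + b) = deg a + deg b" for a b by (simp add: deg_def lookup_add sum.distrib)
  \<comment> \<open>This ideal contains the edge ideal and the powers, but not u, whose only
    monomial has degree |A| and the independent support A.\<close>
  define D where "D = {f \<in> polys {1..n} :: 'k mpoly set. \<forall>m\<in>Poly_Mapping.keys f.
    card A < deg m \<or> (\<exists>e\<in>E. e \<subseteq> Poly_Mapping.keys m)}"
  have D: "P.is_ideal {1..n} D" unfolding D_def
    by (rule monomial_ideal) (auto simp: deg_add keys_plus_nat)
  have "?I \<subseteq> D" by (auto simp: edge_ideal_eq[OF G] D_def)
  moreover have "set gs \<subseteq> D"
  proof
    fix g assume g: "g \<in> set gs"
    then obtain f where f: "f \<in> set fs" "g = f ^ Suc (card A)" by (auto simp: gs_def)
    have deg_pos: "0 < deg a" if "a \<in> Poly_Mapping.keys f" for a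
    proof -
      have "a \<noteq> 0" "Poly_Mapping.keys a \<subseteq> {1..n}" using fs f(1) that by (auto simp: irrelevant_ideal_eq polys_def)
      then obtain v where "v \<in> Poly_Mapping.keys a" "v \<in> {1..n}" by (metis all_not_in_conv keys_eq_empty subsetD)
      then show ?thesis unfolding deg_def by (intro sum_pos2[of _ v]) (auto simp: in_keys_iff)
    qed
    have "k \<le> deg a" if "a \<in> Poly_Mapping.keys (f ^ k)" for a k
      using that
    proof (induction k arbitrary: a)
      case (Suc k)
      then obtain b b' where "b \<in> Poly_Mapping.keys f" "b' \<in> Poly_Mapping.keys (f ^ k)" "a = b + b'"
        by (auto elim: keys_multE)
      then show ?case using Suc.IH[of b'] deg_pos[of b] by (simp add: deg_add)
    qed simp
    then show "g \<in> D" using g gsR f(2) unfolding D_def by (fastforce simp del: power_Suc)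
  qed
  ultimately have "u \<in> D" using P.foldl_extend_least[OF D] u_mem by blast
  moreover have "deg m = card A" using indep(2) by (simp add: deg_def lookup_m sum.If_cases Int_absorb1)
  ultimately show False using indep(1) keys_m by (auto simp: D_def u_def independent_def)
qed

lemma graph_depth_le:
  assumes G: "simple_graph n E" and A: "maximal_independent n E A"
  shows "graph_depth TYPE('k::field) n E \<le> enat (card A)"
proof -
  have "length fs \<le> card A"
    if "set fs \<subseteq> irrelevant_ideal n"
      "regular_sequence (mpoly_ring n) (quotient_module (mpoly_ring n) (edge_ideal n E :: 'k mpoly set)) fs" for fs
    using regular_sequence_length_le[OF G A that(1)]
      regular_sequence_quotient_iff[OF edge_ideal_is_ideal[OF G]] that(2) by blast
  then show ?thesis unfolding graph_depth_def module_depth_def by (intro Sup_least) auto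
qed

text \<open>The sum of all variables is a nonzerodivisor: if y is not in the edge ideal, some
  monomial of y has independent support, and the prime face ideal of that support contains the edge
  ideal but not y. It would have to contain the sum, which it does not when the support is
  nonempty.\<close>

lemma graph_depth_pos:
  assumes G: "simple_graph n E" and n: "1 \<le> n"
  shows "1 \<le> graph_depth TYPE('k::field) n E"
proof -
  let ?l = "\<Sum>i\<in>{1..n}. mvar i :: 'k mpoly"
  have lR: "?l \<in> polys {1..n}" by (intro P.sum_closed mvar_polys)
  have lookup_l: "Poly_Mapping.lookup ?l (Poly_Mapping.single a 1) = 1" if "a \<in> {1..n}" for a
  proof -
    have "Poly_Mapping.lookup ?l (Poly_Mapping.single a 1) = (\<Sum>i\<in>{1..n}. if i = a then 1 else 0)"
      unfolding lookup_sum by (intro sum.cong) (auto simp: mvar_def lookup_single when_def single_index_eq_iff)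
    then show ?thesis using that by simp
  qed
  have "P.nzd {1..n} ?l (edge_ideal n E)" unfolding P.nzd_def
  proof (intro ballI impI)
    fix y :: "'k mpoly" assume y: "y \<in> polys {1..n}" "?l * y \<in> edge_ideal n E"
    have "\<exists>e\<in>E. e \<subseteq> Poly_Mapping.keys m" if m: "m \<in> Poly_Mapping.keys y" for m
    proof (rule ccontr)
      assume none: "\<not> ?thesis"
      \<comment> \<open>The constant monomial has empty support, whose face ideal does contain the
        sum; a single vertex, independent for lack of loops, takes its place.\<close>
      define A where "A = (if m = 0 then {1} else Poly_Mapping.keys m)"
      have "\<not> e \<subseteq> A" if e: "e \<in> E" for e
      proof (cases "m = 0")
        case True
        obtain i j where "e = {i, j}" "i \<noteq> j" using G e by (rule simple_graph_edgeE)
        then show ?thesis using True by (auto simp: A_def)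
      qed (use none e in \<open>auto simp: A_def\<close>)
      moreover have "A \<subseteq> {1..n}" using y(1) m n by (auto simp: A_def polys_def)
      ultimately have "independent n E A" by (simp add: independent_def)
      then have "?l * y \<in> face_ideal {1..n} A" "A \<subseteq> {1..n}"
        using edge_ideal_subset_face_ideal[OF G] y(2) by (auto simp: independent_def)
      moreover have "y \<notin> face_ideal {1..n} A" using m by (auto simp: face_ideal_def A_def intro!: bexI[of _ m])
      ultimately have l: "?l \<in> face_ideal {1..n} A"
        using subst_kernel_prime[OF lR y(1)] by (auto simp: face_ideal_eq_subst_kernel)
      have "A \<noteq> {}" by (simp add: A_def)
      then obtain a where "a \<in> A" by blast
      moreover have "Poly_Mapping.single a 1 \<in> Poly_Mapping.keys ?l"
        using lookup_l[of a] \<open>a \<in> A\<close> \<open>A \<subseteq> {1..n}\<close> unfolding in_keys_iff by auto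
      ultimately show False using l by (auto simp: face_ideal_def)
    qed
    then show "y \<in> edge_ideal n E" using y(1) by (simp add: edge_ideal_eq[OF G])
  qed
  moreover have "?l \<in> irrelevant_ideal n"
    unfolding irrelevant_ideal_eq_face_ideal
    by (intro P.ideal_sum[OF face_ideal_is_ideal]) (simp add: mvar_mem_face_ideal_iff)
  ultimately show ?thesis using graph_depth_ge[OF G, of "[?l]"] by (simp add: one_enat_def)
qed

section \<open>The bound for connected graphs\<close>

lemma maximum_independent_exists:
  assumes "simple_graph n E"
  obtains S where "independent n E S" "\<And>B. independent n E B \<Longrightarrow> card B \<le> card S"
proof -
  have "independent n E {}" using assms by (auto simp: independent_def elim: simple_graph_edgeE)
  moreover have "card B \<le> n" if "independent n E B" for B
    using card_mono[of "{1..n}" B] that by (auto simp: independent_def)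
  ultimately show thesis
    using that ex_has_greatest_nat[of "independent n E" "{}" card "Suc n"]
    by (metis le_imp_less_Suc less_imp_le)
qed

lemma connected_graph_neighbour:
  assumes conn: "connected_graph n E" and v: "v \<in> {1..n}" and n: "2 \<le> n"
  obtains u where "{v, u} \<in> E"
proof -
  define w :: nat where "w = (if v = 1 then 2 else 1)"
  have "w \<in> {1..n}" "w \<noteq> v" using n by (auto simp: w_def)
  then have "(v, w) \<in> {(a, b). {a, b} \<in> E}\<^sup>*" using conn v by (auto simp: connected_graph_def)
  then obtain u where "(v, u) \<in> {(a, b). {a, b} \<in> E}"
    using \<open>w \<noteq> v\<close> by (cases rule: converse_rtranclE) auto
  then show thesis using that by auto
qed

lemma maximal_independentI:
  assumes G: "simple_graph n E" and A: "independent n E A"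
    and max: "\<And>v. v \<in> {1..n} - A \<Longrightarrow> \<not> independent n E (insert v A)"
  shows "maximal_independent n E A"
  unfolding maximal_independent_def
proof (intro conjI ballI A)
  fix v assume v: "v \<in> {1..n} - A"
  then have "insert v A \<subseteq> {1..n}" using A by (auto simp: independent_def)
  then obtain e where e: "e \<in> E" "e \<subseteq> insert v A" using max[OF v] by (auto simp: independent_def)
  obtain i j where ij: "e = {i, j}" "i \<noteq> j" using G e(1) by (rule simple_graph_edgeE)
  have "\<not> e \<subseteq> A" using A e(1) by (auto simp: independent_def)
  then have "(i = v \<and> j \<in> A) \<or> (j = v \<and> i \<in> A)" using ij e(2) by auto
  then show "\<exists>a\<in>A. {v, a} \<in> E" using e(1) ij(1) by (auto simp: insert_commute)
qed

text \<open>
  If a subadditive function had a small value on some set around every point, summing over these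
  sets would make its value on the whole set too small.
\<close>
lemma subadditive_pointwise_average:
  fixes h :: "'a set \<Rightarrow> int"
  assumes W: "finite W" "W \<noteq> {}" and empty: "h {} = 0"
    and sub: "\<And>X Y. X \<subseteq> W \<Longrightarrow> Y \<subseteq> W \<Longrightarrow> h (X \<union> Y) \<le> h X + h Y"
  shows "\<exists>c\<in>W. \<forall>X. c \<in> X \<and> X \<subseteq> W \<longrightarrow> h W \<le> int (card W) * h X"
proof (rule ccontr)
  assume "\<not> ?thesis"
  then have "\<exists>X. c \<in> X \<and> X \<subseteq> W \<and> int (card W) * h X < h W" if "c \<in> W" for c
    using that by (auto simp: not_le)
  then obtain X where X: "\<And>c. c \<in> W \<Longrightarrow> c \<in> X c \<and> X c \<subseteq> W \<and> int (card W) * h (X c) < h W"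
    by metis
  have "h (\<Union>c\<in>D. X c) \<le> (\<Sum>c\<in>D. h (X c))" if "D \<subseteq> W" for D
    using finite_subset[OF that W(1)] that
  proof (induction D rule: finite_induct)
    case (insert c D)
    have "h (X c \<union> (\<Union>c\<in>D. X c)) \<le> h (X c) + h (\<Union>c\<in>D. X c)"
      using insert.prems X by (intro sub) auto
    then show ?case using insert by simp
  qed (simp add: empty)
  moreover have "(\<Union>c\<in>W. X c) = W" using X by blast
  ultimately have "h W \<le> (\<Sum>c\<in>W. h (X c))" by fastforce
  then have "int (card W) * h W \<le> (\<Sum>c\<in>W. int (card W) * h (X c))"
    by (simp add: sum_distrib_left[symmetric] mult_left_mono)
  also have "\<dots> < (\<Sum>c\<in>W. h W)" using X W by (intro sum_strict_mono) auto
  finally show False by simp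
qed

lemma small_maximal_independent:
  assumes G: "simple_graph n E" and conn: "connected_graph n E" and n: "2 \<le> n"
    and S: "independent n E S" and max: "\<And>B. independent n E B \<Longrightarrow> card B \<le> card S"
  shows "\<exists>A. maximal_independent n E A \<and> card S \<le> (n - card S) * (card S - card A + 1)"
proof -
  let ?C = "{1..n} - S"
  have SV: "S \<subseteq> {1..n}" "finite S" using S independent_finite by (auto simp: independent_def)
  have cardC: "card ?C = n - card S" using SV by (simp add: card_Diff_subset)
  have max_S: "maximal_independent n E S"
  proof (rule maximal_independentI[OF G S])
    fix v assume "v \<in> {1..n} - S"
    then have "card (insert v S) = Suc (card S)" using SV by simp
    then show "\<not> independent n E (insert v S)" using max[of "insert v S"] by auto
  qed
  show ?thesis
  proof (cases "card S \<le> card ?C")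
    \<comment> \<open>If S is no larger than its complement, S itself will do, the second factor
      being 1.\<close>
    case True
    then show ?thesis using max_S cardC by auto
  next
    case False
    define N where "N X = {s \<in> S. \<exists>c\<in>X. {c, s} \<in> E}" for X
    have NS: "N X \<subseteq> S" for X by (auto simp: N_def)
    have fN: "finite (N X)" for X using finite_subset[OF NS SV(2)] .
    have N_Un: "N (X \<union> Y) = N X \<union> N Y" for X Y by (auto simp: N_def)
    \<comment> \<open>Connectedness serves here to give every vertex of S a neighbour, which then
      lies outside S.\<close>
    have N_C: "N ?C = S"
    proof
      show "S \<subseteq> N ?C"
      proof
        fix s assume s: "s \<in> S"
        then obtain u where u: "{s, u} \<in> E" using connected_graph_neighbour[OF conn _ n, of s] SV by blast
        then have "u \<in> {1..n}" using G unfolding simple_graph_def by auto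
        moreover have "u \<notin> S" using S s u by (auto simp: independent_def)
        ultimately show "s \<in> N ?C" using s u by (auto simp: N_def insert_commute)
      qed
    qed (rule NS)
    define h where "h X = int (card (N X)) - int (card X)" for X
    have "\<exists>U. U \<subseteq> ?C \<and> (\<forall>X. X \<subseteq> ?C \<longrightarrow> h U \<le> h X)"
    proof -
      have "finite (h ` Pow ?C)" "h ` Pow ?C \<noteq> {}" by auto
      then have "Min (h ` Pow ?C) \<in> h ` Pow ?C" "\<forall>X\<in>Pow ?C. Min (h ` Pow ?C) \<le> h X" by (auto intro: Min_in)
      then show ?thesis by (metis (no_types, lifting) PowD PowI imageE)
    qed
    \<comment> \<open>Minimality of U makes the contracted excess \<open>h'\<close> below
      nonnegative. The intersection term in the submodular inequality can then be discarded, which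
      leaves the subadditivity needed for the averaging.\<close>
    then obtain U where U: "U \<subseteq> ?C" "\<And>X. X \<subseteq> ?C \<Longrightarrow> h U \<le> h X" by blast
    have hU: "h U \<le> 0" using U(2)[of "{}"] by (simp add: h_def N_def)
    define W where "W = ?C - U"
    have fin: "finite U" "finite W" using U(1) finite_subset by (auto simp: W_def)
    have UW: "U \<union> W = ?C" "U \<inter> W = {}" using U(1) by (auto simp: W_def)
    define h' where "h' X = int (card (N X - N U)) - int (card X)" for X
    have h'_eq: "h' X = h (U \<union> X) - h U" if "X \<subseteq> W" for X
    proof -
      have fX: "finite X" "U \<inter> X = {}" using that fin UW finite_subset by auto
      have "card (N (U \<union> X)) = card (N U) + card (N X - N U)"
        unfolding N_Un using fN by (subst card_Un_disjoint[symmetric]) (auto intro: arg_cong[where f = card])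
      then show ?thesis using fX fin(1) by (simp add: h'_def h_def card_Un_disjoint)
    qed
    have h'_nonneg: "0 \<le> h' X" if "X \<subseteq> W" for X
      using U(2)[of "U \<union> X"] that UW h'_eq[OF that] by auto
    have hC: "h ?C = int (card S) - int (card ?C)" unfolding h_def N_C ..
    have h'W: "int (card S) - int (card ?C) \<le> h' W" using h'_eq[of W] UW(1) hU hC by simp
    \<comment> \<open>Here S being larger than its complement is used: the excess of the whole
      complement is positive, that of U is not.\<close>
    have "W \<noteq> {}"
    proof
      assume "W = {}"
      then have "U = ?C" using UW by simp
      then show False using hU hC False by simp
    qed
    have sub: "h' (X \<union> Y) \<le> h' X + h' Y" if XY: "X \<subseteq> W" "Y \<subseteq> W" for X Y
    proof -
      have fXY: "finite X" "finite Y" using XY fin finite_subset by auto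
      let ?N = "\<lambda>X. N X - N U"
      have "card (?N (X \<union> Y)) + card (?N X \<inter> ?N Y) = card (?N X) + card (?N Y)"
        using card_Un_Int[of "?N X" "?N Y"] fN by (simp add: N_Un Un_Diff)
      moreover have "card (?N (X \<inter> Y)) \<le> card (?N X \<inter> ?N Y)"
        using fN by (intro card_mono) (auto simp: N_def)
      moreover have "card (X \<union> Y) + card (X \<inter> Y) = card X + card Y" using card_Un_Int[OF fXY] by simp
      moreover have "0 \<le> h' (X \<inter> Y)" using XY by (intro h'_nonneg) auto
      ultimately show ?thesis unfolding h'_def by linarith
    qed
    have h'_empty: "h' {} = 0" by (simp add: h'_def N_def)
    obtain c where c: "c \<in> W" "\<And>X. c \<in> X \<Longrightarrow> X \<subseteq> W \<Longrightarrow> h' W \<le> int (card W) * h' X"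
      using subadditive_pointwise_average[OF fin(2) \<open>W \<noteq> {}\<close> h'_empty sub] by blast
    \<comment> \<open>A largest independent set around c outside S blocks every further vertex
      outside S, which is what makes A below maximal.\<close>
    let ?P = "\<lambda>T. c \<in> T \<and> T \<subseteq> ?C \<and> independent n E T"
    have "?P {c}" using c(1) by (auto simp: W_def independent_def elim: simple_graph_edgeE[OF G])
    moreover have "card T \<le> n" if "?P T" for T
      using card_mono[of "{1..n}" T] that by (auto simp: independent_def)
    ultimately obtain T where T: "?P T" "\<And>T'. ?P T' \<Longrightarrow> card T' \<le> card T"
      using ex_has_greatest_nat[of ?P "{c}" card "Suc n"] by (metis (no_types, lifting) le_imp_less_Suc less_imp_le)
    have fT: "finite T" using T independent_finite by blast
    define A where "A = T \<union> (S - N T)"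
    \<comment> \<open>Trading the neighbours of X in S for X preserves independence; the size drops
      by exactly \<open>h X\<close>, as \<open>card_exchange\<close> records.\<close>
    have exchange: "independent n E (X \<union> (S - N X))" if X: "X \<subseteq> ?C" "independent n E X" for X
    proof -
      have "\<not> e \<subseteq> X \<union> (S - N X)" if e: "e \<in> E" for e
      proof
        assume sub: "e \<subseteq> X \<union> (S - N X)"
        obtain i j where ij: "e = {i, j}" using G e by (rule simple_graph_edgeE)
        have "\<not> e \<subseteq> X" "\<not> e \<subseteq> S" using X(2) S e by (auto simp: independent_def)
        then consider "i \<in> X" "j \<in> S - N X" | "j \<in> X" "i \<in> S - N X" using ij sub by auto
        then show False using e ij by cases (auto simp: N_def insert_commute)
      qed
      then show ?thesis using X SV by (auto simp: independent_def)
    qed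
    have card_exchange: "int (card (X \<union> (S - N X))) = int (card S) - h X" if X: "X \<subseteq> ?C" for X
    proof -
      have "finite X" using X finite_subset by blast
      moreover have "card (N X) \<le> card S" using NS SV(2) by (rule card_mono[rotated])
      ultimately show ?thesis using X SV(2) NS fN
        by (subst card_Un_disjoint) (auto simp: h_def card_Diff_subset of_nat_diff)
    qed
    have A_max: "maximal_independent n E A"
    proof (rule maximal_independentI[OF G])
      show "independent n E A" using exchange T(1) by (simp add: A_def)
      fix v assume v: "v \<in> {1..n} - A"
      show "\<not> independent n E (insert v A)"
      proof (cases "v \<in> S")
        case True
        then have "v \<in> N T" using v by (auto simp: A_def)
        then obtain t where "t \<in> T" "{t, v} \<in> E" by (auto simp: N_def)
        then show ?thesis by (auto simp: independent_def A_def intro!: bexI[of _ "{t, v}"])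
      next
        case False
        then have "card (insert v T) = Suc (card T)" using v fT by (simp add: A_def)
        then have "\<not> ?P (insert v T)" using T(2)[of "insert v T"] by auto
        then have "\<not> independent n E (insert v T)" using T(1) v False by auto
        then show ?thesis using T(1) v by (auto simp: independent_def A_def)
      qed
    qed
    have hT: "int (card A) = int (card S) - h T" using card_exchange T(1) by (simp add: A_def)
    \<comment> \<open>Exchanging along the independent set \<open>T \<inter> U\<close> cannot beat
      the maximum S, so its excess is nonnegative and that part of T may be dropped from the
      estimate.\<close>
    have "h' (T \<inter> W) \<le> h T"
    proof -
      have "independent n E (T \<inter> U)" using T(1) by (auto simp: independent_def)
      moreover have TU: "T \<inter> U \<subseteq> ?C" using U(1) by blast
      ultimately have "card (T \<inter> U \<union> (S - N (T \<inter> U))) \<le> card S" by (intro max exchange)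
      then have "0 \<le> h (T \<inter> U)" using card_exchange[OF TU] by linarith
      moreover have "card T = card (T \<inter> U) + card (T \<inter> W)"
      proof -
        have "T = (T \<inter> U) \<union> (T \<inter> W)" using T(1) UW(1) by blast
        then show ?thesis using card_Un_disjoint[of "T \<inter> U" "T \<inter> W"] fT UW(2) by auto
      qed
      moreover have "card (N (T \<inter> U)) + card (N (T \<inter> W) - N U) \<le> card (N T)"
      proof -
        have "card (N (T \<inter> U)) + card (N (T \<inter> W) - N U) = card (N (T \<inter> U) \<union> (N (T \<inter> W) - N U))"
          using fN by (subst card_Un_disjoint) (auto simp: N_def)
        also have "\<dots> \<le> card (N T)" using fN by (intro card_mono) (auto simp: N_def)
        finally show ?thesis .
      qed
      ultimately show ?thesis by (simp add: h_def h'_def)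
    qed
    moreover have "h' W \<le> int (card W) * h' (T \<inter> W)" using c T(1) by auto
    moreover have "int (card W) * h' (T \<inter> W) \<le> int (card ?C) * h' (T \<inter> W)"
      using h'_nonneg[of "T \<inter> W"] by (intro mult_right_mono) (auto simp: W_def intro!: card_mono)
    ultimately have "int (card S) - int (card ?C) \<le> int (card ?C) * h T"
      using h'W mult_left_mono[of "h' (T \<inter> W)" "h T" "int (card ?C)"] by linarith
    then have "int (card S) \<le> int (card ?C) * (h T + 1)" by (simp add: algebra_simps)
    \<comment> \<open>Nonnegative excess means |A| <= |S|, so the truncated difference in the claim
      is the integer \<open>h T\<close>.\<close>
    moreover have "0 \<le> h T" using \<open>h' (T \<inter> W) \<le> h T\<close> h'_nonneg[of "T \<inter> W"] by simp
    then have "h T + 1 = int (card S - card A + 1)" using hT by simp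
    ultimately have "int (card S) \<le> int (card ?C) * int (card S - card A + 1)" by metis
    then have "int (card S) \<le> int (card ?C * (card S - card A + 1))" by (simp only: of_nat_mult)
    then have "card S \<le> card ?C * (card S - card A + 1)" by linarith
    then show ?thesis using A_max cardC by auto
  qed
qed

lemma Graph_dim_depth_subset:
  assumes n: "2 \<le> n"
  shows "Graph_dim_depth TYPE('k::field) n \<subseteq> C_star n"
proof
  fix x assume "x \<in> Graph_dim_depth TYPE('k) n"
  then obtain d p E where x: "x = (d, p)" and G: "simple_graph n E" and conn: "connected_graph n E"
    and dim: "graph_dim TYPE('k) n E = enat d" and depth: "graph_depth TYPE('k) n E = enat p"
    by (auto simp: Graph_dim_depth_def)
  obtain S where S: "independent n E S" "\<And>B. independent n E B \<Longrightarrow> card B \<le> card S"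
    using maximum_independent_exists[OF G] by blast
  have d: "d = card S" using graph_dim_eq[OF G S, where ?'k = 'k] dim by simp
  obtain A where A: "maximal_independent n E A" "card S \<le> (n - card S) * (card S - card A + 1)"
    using small_maximal_independent[OF G conn n S] by blast
  have p: "p \<le> card A" "1 \<le> p"
    using graph_depth_le[OF G A(1), where ?'k = 'k] graph_depth_pos[OF G, where ?'k = 'k] n depth
    by (auto simp: one_enat_def)
  have "card A \<le> card S" using A(1) S(2) by (simp add: maximal_independent_def)
  moreover have "d \<le> n - Suc 0"
  proof -
    obtain u where u: "{1, u} \<in> E" using connected_graph_neighbour[OF conn _ n, of 1] n by auto
    then have "{1, u} \<subseteq> {1..n}" using G unfolding simple_graph_def nsets_def by blast
    then have "S \<noteq> {1..n}" using S(1) u by (auto simp: independent_def simp del: insert_subset)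
    then have "S \<subset> {1..n}" using S(1) by (auto simp: independent_def)
    then have "card S < n" using psubset_card_mono[of "{1..n}" S] by simp
    then show ?thesis using d by simp
  qed
  moreover have "d \<le> (n - d) * Suc (d - p)"
  proof -
    have "d \<le> (n - d) * (d - card A + 1)" using A(2) unfolding d .
    also have "\<dots> \<le> (n - d) * Suc (d - p)" using p(1) by (intro mult_le_mono2) simp
    finally show ?thesis .
  qed
  ultimately show "x \<in> C_star n" using p d by (simp add: C_star_def x)
qed

section \<open>Cliques with leaves\<close>

lemma independentD: "independent n E A \<Longrightarrow> {a, b} \<in> E \<Longrightarrow> a \<in> A \<Longrightarrow> b \<notin> A"
  by (auto simp: independent_def dest!: bspec)

text \<open>The windows enter only through these properties. \<open>N_card\<close> and
  \<open>N_transversal\<close> together say that each neighbourhood has one leaf in every residue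
  class modulo e; the shift by 1 is due to leaves being numbered from 1.\<close>

locale clique_with_leaves =
  fixes n d e :: nat and N :: "nat \<Rightarrow> nat set"
  assumes e_pos: "1 \<le> e" and e_le: "e \<le> d" and d_less: "d < n"
    and N_subset: "\<And>c. c \<in> {d<..n} \<Longrightarrow> N c \<subseteq> {1..d}"
    and N_transversal: "\<And>c s t. c \<in> {d<..n} \<Longrightarrow> s \<in> N c \<Longrightarrow> t \<in> N c \<Longrightarrow>
      (s - 1) mod e = (t - 1) mod e \<Longrightarrow> s = t"
    and N_card: "\<And>c. c \<in> {d<..n} \<Longrightarrow> card (N c) = e"
    and N_cover: "\<And>s. s \<in> {1..d} \<Longrightarrow> \<exists>c\<in>{d<..n}. s \<in> N c"
begin

abbreviation "leaves \<equiv> {1..d}"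
abbreviation "core \<equiv> {d<..n}"

definition edges :: "nat set set" where
  "edges = {{c, c'} | c c'. c \<in> core \<and> c' \<in> core \<and> c \<noteq> c'} \<union> {{s, c} | s c. c \<in> core \<and> s \<in> N c}"

lemma clique_edge: "c \<in> core \<Longrightarrow> c' \<in> core \<Longrightarrow> c \<noteq> c' \<Longrightarrow> {c, c'} \<in> edges"
  unfolding edges_def by blast

lemma leaf_edge: "c \<in> core \<Longrightarrow> s \<in> N c \<Longrightarrow> {s, c} \<in> edges"
  unfolding edges_def by blast

lemma edgesE:
  assumes "{i, j} \<in> edges"
  obtains "i \<in> core" "j \<in> core" "i \<noteq> j" | "j \<in> core" "i \<in> N j" | "i \<in> core" "j \<in> N i"
  using assms unfolding edges_def by (auto simp: doubleton_eq_iff)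

lemma leaf_not_clique: "s \<in> leaves \<Longrightarrow> s \<notin> core"
  by auto

lemma simple_graph_edges: "simple_graph n edges"
proof -
  have "f \<in> [{1..n}]\<^bsup>2\<^esup>" if "f \<in> edges" for f
  proof -
    have "\<exists>i j. f = {i, j}" using that unfolding edges_def by blast
    then obtain i j where f: "f = {i, j}" by blast
    then have "{i, j} \<in> edges" using that by simp
    then show ?thesis unfolding f
    proof (cases rule: edgesE)
      case 2
      then show "{i, j} \<in> [{1..n}]\<^bsup>2\<^esup>" using N_subset[of j] d_less by fastforce
    next
      case 3
      then show "{i, j} \<in> [{1..n}]\<^bsup>2\<^esup>" using N_subset[of i] d_less by fastforce
    qed auto
  qed
  then show ?thesis by (auto simp: simple_graph_def)
qed

lemma connected_graph_edges: "connected_graph n edges"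
proof -
  let ?R = "{(a, b). {a, b} \<in> edges}"
  have sym: "(b, a) \<in> ?R\<^sup>*" if "(a, b) \<in> ?R\<^sup>*" for a b
  proof -
    have "sym ?R" by (auto simp: sym_def insert_commute)
    then show ?thesis using that by (meson sym_rtrancl symD)
  qed
  have n: "n \<in> core" using d_less by simp
  have core: "(c, n) \<in> ?R\<^sup>*" if "c \<in> core" for c
    using clique_edge[OF that n] by (cases "c = n") auto
  have to_n: "(v, n) \<in> ?R\<^sup>*" if "v \<in> {1..n}" for v
  proof (cases "v \<in> core")
    case False
    then have "v \<in> leaves" using that by auto
    then obtain c where c: "c \<in> core" "v \<in> N c" using N_cover by blast
    then have "(v, c) \<in> ?R" using leaf_edge by simp
    then show ?thesis using core[OF c(1)] by (rule converse_rtrancl_into_rtrancl)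
  qed (rule core)
  show ?thesis unfolding connected_graph_def
    by (intro ballI rtrancl_trans[OF to_n sym[OF to_n]])
qed

lemma independent_leaves: "independent n edges leaves"
  unfolding independent_def
proof (intro conjI ballI notI)
  fix f assume "f \<in> edges" "f \<subseteq> leaves"
  then show False unfolding edges_def by auto
qed (use d_less in auto)

text \<open>At most one clique vertex can occur, and it excludes its e >= 1 leaves.\<close>

lemma independent_card_le: "independent n edges B \<Longrightarrow> card B \<le> d"
proof -
  assume B: "independent n edges B"
  then have BV: "B \<subseteq> {1..n}" "finite B" using independent_finite by (auto simp: independent_def)
  show ?thesis
  proof (cases "B \<inter> core = {}")
    case True
    then have "B \<subseteq> leaves" using BV by fastforce
    then show ?thesis using card_mono[of leaves B] by simp
  next
    case False
    then obtain c where c: "c \<in> B" "c \<in> core" by blast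
    have "c' = c" if "c' \<in> B" "c' \<in> core" for c'
      using independentD[OF B clique_edge[OF that(2) c(2)] that(1)] c(1) by blast
    moreover have "s \<notin> B" if "s \<in> N c" for s
      using independentD[OF B leaf_edge[OF c(2) that]] c(1) by blast
    ultimately have "B \<subseteq> insert c (leaves - N c)" using BV by fastforce
    then have "card B \<le> card (insert c (leaves - N c))" by (intro card_mono) auto
    also have "\<dots> \<le> Suc (d - e)"
      using N_subset[OF c(2)] N_card[OF c(2)] finite_subset[OF N_subset[OF c(2)]]
      by (simp add: card_insert_if card_Diff_subset)
    finally show ?thesis using e_pos e_le by simp
  qed
qed

lemma graph_dim_edges: "graph_dim TYPE('k::field) n edges = enat d"
  using graph_dim_eq[OF simple_graph_edges independent_leaves] independent_card_le by simp

text \<open>Its d - e + 1 elements bound the depth by the length that the regular sequence below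
  attains.\<close>

lemma maximal_independent_clique_vertex:
  assumes c: "c \<in> core"
  shows "maximal_independent n edges (insert c (leaves - N c))"
  unfolding maximal_independent_def independent_def
proof (intro conjI ballI notI)
  fix f assume f: "f \<in> edges" "f \<subseteq> insert c (leaves - N c)"
  then have "\<exists>i j. f = {i, j}" unfolding edges_def by blast
  then obtain i j where ij: "f = {i, j}" by blast
  then have "{i, j} \<in> edges" using f by simp
  then show False
  proof (cases rule: edgesE)
    case 1
    then have "i = c" "j = c" using f(2) leaf_not_clique unfolding ij by blast+
    then show False using 1 by simp
  next
    case 2
    then have "j = c" "i \<noteq> c" using f(2) leaf_not_clique N_subset[of j] c unfolding ij by blast+
    then show False using 2 f(2) ij by auto
  next
    case 3
    then have "i = c" "j \<noteq> c" using f(2) leaf_not_clique N_subset[of i] c unfolding ij by blast+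
    then show False using 3 f(2) ij by auto
  qed
next
  fix v assume v: "v \<in> {1..n} - insert c (leaves - N c)"
  then consider "v \<in> core" "v \<noteq> c" | "v \<in> N c" by fastforce
  then have "{v, c} \<in> edges" using clique_edge leaf_edge c by cases auto
  then show "\<exists>a\<in>insert c (leaves - N c). {v, a} \<in> edges" by blast
qed (use d_less c in auto)

lemma graph_depth_edges_le: "graph_depth TYPE('k::field) n edges \<le> enat (d - e + 1)"
proof -
  have n: "n \<in> core" using d_less by simp
  have "card (insert n (leaves - N n)) = Suc (d - e)"
    using N_subset[OF n] N_card[OF n] finite_subset[OF N_subset[OF n]] n
    by (subst card_insert_disjoint) (auto simp: card_Diff_subset)
  then show ?thesis
    using graph_depth_le[OF simple_graph_edges maximal_independent_clique_vertex[OF n], where ?'k = 'k] by simp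
qed

section \<open>Linear forms on the leaves and the primes above them\<close>

definition res :: "nat \<Rightarrow> nat" where
  "res s = (s - 1) mod e + 1"

text \<open>
  Modulo the first \<open>i\<close> of the linear forms \<open>\<theta> k\<close>, the leaf \<open>s\<close> is identified with \<open>rep i s\<close>.
\<close>
definition rep :: "nat \<Rightarrow> nat \<Rightarrow> nat" where
  "rep i s = (if s \<le> e + i then res s else s)"

definition \<theta> :: "nat \<Rightarrow> 'k::field mpoly" where
  "\<theta> k = mvar (e + k + 1) - mvar (res (e + k + 1))"

definition J :: "nat \<Rightarrow> 'k::field mpoly set" where
  "J i = foldl (P.extend {1..n}) (edge_ideal n edges) (map \<theta> [0..<i])"

text \<open>Its kernel and those of \<open>clique_subst i c\<close> are the primes with intersection
  \<open>J i\<close>. Here all clique variables vanish; there only x_c survives among them, and the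
  classes of leaves that meet \<open>N c\<close> vanish.\<close>

definition leaf_subst :: "nat \<Rightarrow> nat \<Rightarrow> 'k::field mpoly" where
  "leaf_subst i v = (if v \<in> core then 0 else mvar (rep i v))"

definition clique_subst :: "nat \<Rightarrow> nat \<Rightarrow> nat \<Rightarrow> 'k::field mpoly" where
  "clique_subst i c v =
    (if v \<in> core then (if v = c then mvar c else 0)
     else if rep i v \<in> rep i ` N c then 0 else mvar (rep i v))"

lemma res_bounds: "1 \<le> res s" "res s \<le> e"
  using e_pos mod_less_divisor[of e "s - 1"] by (simp_all add: res_def Suc_le_eq)

lemma res_idem: "res (res s) = res s"
  by (simp add: res_def)

lemma res_self: "1 \<le> s \<Longrightarrow> s \<le> e \<Longrightarrow> res s = s"
  by (simp add: res_def)

lemma rep_bounds: "s \<in> leaves \<Longrightarrow> rep i s \<in> leaves"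
  using res_bounds[of s] e_le by (auto simp: rep_def)

lemma \<theta>_polys: "i < d - e \<Longrightarrow> \<theta> i \<in> polys {1..n}"
  unfolding \<theta>_def using res_bounds[of "e + i + 1"] e_le d_less
  by (intro P.diff_closed mvar_polys) auto

lemma \<theta>_list_polys: "i \<le> d - e \<Longrightarrow> set (map \<theta> [0..<i]) \<subseteq> (polys {1..n} :: 'k::field mpoly set)"
proof
  fix f :: "'k::field mpoly"
  assume i: "i \<le> d - e" and "f \<in> set (map \<theta> [0..<i])"
  then obtain k where "k < i" "f = \<theta> k" by auto
  then show "f \<in> polys {1..n}" using \<theta>_polys[of k] i by simp
qed

lemma J_ideal: "i \<le> d - e \<Longrightarrow> P.is_ideal {1..n} (J i :: 'k::field mpoly set)"
  unfolding J_def by (intro P.foldl_extend_ideal edge_ideal_is_ideal simple_graph_edges \<theta>_list_polys)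

lemma \<theta>_mem_J: "k < i \<Longrightarrow> i \<le> d - e \<Longrightarrow> \<theta> k \<in> J i"
  using P.foldl_extend_generators[OF edge_ideal_is_ideal[OF simple_graph_edges] \<theta>_list_polys, of i]
  unfolding J_def by auto

lemma edge_mem_J: "{a, b} \<in> edges \<Longrightarrow> mvar a * mvar b \<in> J i"
proof -
  assume ab: "{a, b} \<in> edges"
  then have "{a, b} \<subseteq> {1..n}" using simple_graph_edges unfolding simple_graph_def nsets_def by blast
  then have "mvar a * mvar b \<in> edge_ideal n edges"
    unfolding edge_ideal_eq[OF simple_graph_edges] using ab
    by (auto simp: mvar_mult_mvar keys_plus_nat intro!: single_polys bexI[of _ "{a, b}"])
  then show ?thesis using P.foldl_extend_subset unfolding J_def by blast
qed

lemma J_least: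
  assumes K: "P.is_ideal {1..n} K" and edge: "\<And>a b. {a, b} \<in> edges \<Longrightarrow> mvar a * mvar b \<in> K"
    and \<theta>: "\<And>k. k < i \<Longrightarrow> \<theta> k \<in> K"
  shows "J i \<subseteq> K"
  unfolding J_def edge_ideal_def
  by (intro P.foldl_extend_least K genideal_least) (use edge \<theta> in auto)

lemma rep_\<theta>: "k < i \<Longrightarrow> rep i (e + k + 1) = rep i (res (e + k + 1))"
  using res_bounds[of "e + k + 1"] by (simp add: rep_def res_idem)

lemma subst_\<theta>: "subst \<rho> (\<theta> k) = \<rho> (e + k + 1) - \<rho> (res (e + k + 1))"
  by (simp only: \<theta>_def subst_diff subst_mvar)

lemma J_subset_leaf_kernel:
  assumes i: "i \<le> d - e"
  shows "J i \<subseteq> (subst_kernel {1..n} (leaf_subst i) :: 'k::field mpoly set)"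
proof (rule J_least[OF subst_kernel_ideal])
  fix a b assume ab: "{a, b} \<in> edges"
  then have "{a, b} \<subseteq> {1..n}" using simple_graph_edges unfolding simple_graph_def nsets_def by blast
  then have "mvar a * mvar b \<in> (polys {1..n} :: 'k mpoly set)" by (intro P.mult_closed mvar_polys) auto
  moreover have "leaf_subst i a * leaf_subst i b = (0 :: 'k mpoly)"
    using ab by (cases rule: edgesE) (auto simp: leaf_subst_def)
  ultimately show "mvar a * mvar b \<in> (subst_kernel {1..n} (leaf_subst i) :: 'k mpoly set)"
    by (simp add: subst_kernel_def subst_mult subst_mvar)
next
  fix k assume k: "k < i"
  have "res (e + k + 1) \<in> leaves" "e + k + 1 \<in> leaves" using res_bounds[of "e + k + 1"] e_le k i by auto
  then have "subst (leaf_subst i) (\<theta> k) = (0 :: 'k mpoly)"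
    unfolding subst_\<theta> leaf_subst_def using rep_\<theta>[OF k] leaf_not_clique by auto
  then show "\<theta> k \<in> (subst_kernel {1..n} (leaf_subst i) :: 'k mpoly set)"
    using \<theta>_polys[of k] k i by (simp add: subst_kernel_def)
qed

lemma J_subset_clique_kernel:
  assumes i: "i \<le> d - e" and c: "c \<in> core"
  shows "J i \<subseteq> (subst_kernel {1..n} (clique_subst i c) :: 'k::field mpoly set)"
proof (rule J_least[OF subst_kernel_ideal])
  fix a b assume ab: "{a, b} \<in> edges"
  then have "{a, b} \<subseteq> {1..n}" using simple_graph_edges unfolding simple_graph_def nsets_def by blast
  then have "mvar a * mvar b \<in> (polys {1..n} :: 'k mpoly set)" by (intro P.mult_closed mvar_polys) auto
  moreover have "clique_subst i c a * clique_subst i c b = (0 :: 'k mpoly)"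
    using ab
  proof (cases rule: edgesE)
    case 2
    then show ?thesis using N_subset[of b] by (auto simp: clique_subst_def)
  next
    case 3
    then show ?thesis using N_subset[of a] by (auto simp: clique_subst_def)
  qed (auto simp: clique_subst_def)
  ultimately show "mvar a * mvar b \<in> (subst_kernel {1..n} (clique_subst i c) :: 'k mpoly set)"
    by (simp add: subst_kernel_def subst_mult subst_mvar)
next
  fix k assume k: "k < i"
  have "res (e + k + 1) \<in> leaves" "e + k + 1 \<in> leaves" using res_bounds[of "e + k + 1"] e_le k i by auto
  then have "subst (clique_subst i c) (\<theta> k) = (0 :: 'k mpoly)"
    unfolding subst_\<theta> clique_subst_def using rep_\<theta>[OF k] leaf_not_clique by auto
  then show "\<theta> k \<in> (subst_kernel {1..n} (clique_subst i c) :: 'k mpoly set)"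
    using \<theta>_polys[of k] k i by (simp add: subst_kernel_def)
qed

lemma mvar_rep_mem_J:
  assumes i: "i \<le> d - e" and s: "s \<in> leaves"
  shows "mvar s - mvar (rep i s) \<in> (J i :: 'k::field mpoly set)"
proof (cases "e < s \<and> s \<le> e + i")
  case True
  then have "mvar s - mvar (rep i s) = (\<theta> (s - e - 1) :: 'k mpoly)" by (simp add: \<theta>_def rep_def)
  moreover have "s - e - 1 < i" using True by auto
  ultimately show ?thesis using \<theta>_mem_J[OF _ i] by metis
next
  case False
  then have "rep i s = s" using s res_self[of s] by (auto simp: rep_def)
  then show ?thesis using P.ideal_zero[OF J_ideal[OF i]] by simp
qed

text \<open>The colon ideal of \<open>J i\<close> by x_c contains the difference of each variable
  and its value under the substitution, hence the whole kernel.\<close>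

lemma mvar_mult_clique_kernel:
  assumes i: "i \<le> d - e" and c: "c \<in> core" and g: "g \<in> subst_kernel {1..n} (clique_subst i c)"
  shows "mvar c * g \<in> (J i :: 'k::field mpoly set)"
proof -
  note J = J_ideal[OF i, where ?'k = 'k]
  have cR: "mvar c \<in> (polys {1..n} :: 'k mpoly set)" using c by (intro mvar_polys) auto
  let ?Q = "{g \<in> polys {1..n}. mvar c * g \<in> (J i :: 'k mpoly set)}"
  have Q: "P.is_ideal {1..n} ?Q" by (rule P.ideal_colon[OF J cR])
  have JQ: "x \<in> ?Q" if "x \<in> J i" for x using that P.ideal_sub[OF J] P.ideal_mult[OF J cR] by auto
  have leaf: "mvar v - mvar (rep i v) \<in> ?Q" if "v \<in> leaves" for v
    using JQ mvar_rep_mem_J[OF i that] by blast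
  have "g - subst (clique_subst i c) g \<in> ?Q"
  proof (rule diff_subst_mem_ideal[OF Q])
    fix v assume v: "v \<in> {1..n}"
    have vR: "mvar v \<in> (polys {1..n} :: 'k mpoly set)" using v by (rule mvar_polys)
    show "(clique_subst i c v :: 'k mpoly) \<in> polys {1..n} \<and> mvar v - clique_subst i c v \<in> ?Q"
    proof (cases "v \<in> core")
      case True
      show ?thesis
      proof (cases "v = c")
        case True
        then show ?thesis using cR c P.ideal_zero[OF Q] by (simp add: clique_subst_def)
      next
        case False
        then have "mvar c * mvar v \<in> (J i :: 'k mpoly set)"
          using clique_edge[OF c \<open>v \<in> core\<close>] edge_mem_J by auto
        then show ?thesis using True False vR by (simp add: clique_subst_def P.zero_closed)
      qed
    next
      case False
      then have s: "v \<in> leaves" using v by auto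
      have rR: "mvar (rep i v) \<in> (polys {1..n} :: 'k mpoly set)"
        using rep_bounds[OF s, of i] d_less by (intro mvar_polys) auto
      show ?thesis
      proof (cases "rep i v \<in> rep i ` N c")
        case True
        then obtain t where t: "t \<in> N c" "rep i v = rep i t" by blast
        have tl: "t \<in> leaves" using t N_subset[OF c] by blast
        have "{t, c} \<in> edges" using leaf_edge[OF c t(1)] .
        then have "mvar c * mvar t \<in> (J i :: 'k mpoly set)" using edge_mem_J[of c t] by (simp add: insert_commute)
        then have "mvar t \<in> ?Q" using tl d_less by (auto intro: mvar_polys)
        \<comment> \<open>Modulo \<open>?Q\<close> the variables of v and t agree with that of their
          common representative, and x_t lies in \<open>?Q\<close> because t and c are
          adjacent.\<close>
        then have "(mvar v - mvar (rep i v)) - (mvar t - mvar (rep i t)) + mvar t \<in> ?Q"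
          by (rule P.ideal_add[OF Q P.ideal_diff[OF Q leaf[OF s] leaf[OF tl]]])
        then show ?thesis using True False t(2) by (auto simp: clique_subst_def P.zero_closed)
      next
        case nin: False
        then show ?thesis using leaf[OF s] False rR by (auto simp: clique_subst_def)
      qed
    qed
  next
    show "g \<in> polys {1..n}" using g by (simp add: subst_kernel_def)
  qed
  then show ?thesis using g by (simp add: subst_kernel_def)
qed

text \<open>
  Modulo the clique variables \<open>x\<^sub>c\<close> an element of the leaf kernel lies in \<open>J i\<close>; the coefficient of
  \<open>x\<^sub>c\<close> then lies in the clique kernel of \<open>c\<close>, as that is prime and misses \<open>x\<^sub>c\<close>, and \<open>x\<^sub>c\<close> multiplies
  this kernel into \<open>J i\<close>.
\<close>
lemma kernels_subset_J:
  assumes i: "i \<le> d - e"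
    and leaf: "f \<in> subst_kernel {1..n} (leaf_subst i)"
    and core: "\<And>c. c \<in> core \<Longrightarrow> f \<in> subst_kernel {1..n} (clique_subst i c)"
  shows "f \<in> (J i :: 'k::field mpoly set)"
proof -
  note J = J_ideal[OF i, where ?'k = 'k]
  have cR: "mvar c \<in> (polys {1..n} :: 'k mpoly set)" if "c \<in> core" for c
    using that by (intro mvar_polys) auto
  \<comment> \<open>The ideal generated by \<open>J i\<close> and the clique variables, with the
    coefficients as explicit witnesses because they are examined one at a time.\<close>
  define K where "K = {f \<in> polys {1..n}. \<exists>g. (\<forall>c\<in>core. g c \<in> polys {1..n}) \<and>
    f - (\<Sum>c\<in>core. mvar c * g c) \<in> (J i :: 'k mpoly set)}"
  have K: "P.is_ideal {1..n} K"
  proof (rule P.is_idealI)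
    show "0 \<in> K" using P.ideal_zero[OF J] P.zero_closed by (auto simp: K_def intro!: exI[of _ "\<lambda>_. 0"])
  next
    fix a b assume "a \<in> K" "b \<in> K"
    then obtain g g' where ab: "a \<in> polys {1..n}" "b \<in> polys {1..n}"
      and g: "\<forall>c\<in>core. g c \<in> polys {1..n}" "a - (\<Sum>c\<in>core. mvar c * g c) \<in> J i"
      and g': "\<forall>c\<in>core. g' c \<in> polys {1..n}" "b - (\<Sum>c\<in>core. mvar c * g' c) \<in> J i"
      unfolding K_def by blast
    have eq: "a + b - (\<Sum>c\<in>core. mvar c * (g c + g' c)) =
        (a - (\<Sum>c\<in>core. mvar c * g c)) + (b - (\<Sum>c\<in>core. mvar c * g' c))"
      by (simp add: distrib_left sum.distrib)
    have "a + b - (\<Sum>c\<in>core. mvar c * (g c + g' c)) \<in> J i" unfolding eq by (rule P.ideal_add[OF J g(2) g'(2)])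
    moreover have "\<forall>c\<in>core. g c + g' c \<in> polys {1..n}" using g(1) g'(1) P.add_closed by blast
    ultimately show "a + b \<in> K" unfolding K_def using P.add_closed[OF ab]
      by (intro CollectI conjI exI[of _ "\<lambda>c. g c + g' c"])
  next
    fix r a :: "'k mpoly" assume r: "r \<in> polys {1..n}" and "a \<in> K"
    then obtain g where a: "a \<in> polys {1..n}"
      and g: "\<forall>c\<in>core. g c \<in> polys {1..n}" "a - (\<Sum>c\<in>core. mvar c * g c) \<in> J i"
      unfolding K_def by blast
    have eq: "r * a - (\<Sum>c\<in>core. mvar c * (r * g c)) = r * (a - (\<Sum>c\<in>core. mvar c * g c))"
      by (simp add: right_diff_distrib sum_distrib_left mult.left_commute)
    have "r * a - (\<Sum>c\<in>core. mvar c * (r * g c)) \<in> J i" unfolding eq by (rule P.ideal_mult[OF J r g(2)])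
    moreover have "\<forall>c\<in>core. r * g c \<in> polys {1..n}" using g(1) P.mult_closed[OF r] by blast
    ultimately show "r * a \<in> K" unfolding K_def using P.mult_closed[OF r a]
      by (intro CollectI conjI exI[of _ "\<lambda>c. r * g c"])
  qed (auto simp: K_def)
  have JK: "x \<in> K" if "x \<in> J i" for x
    using that P.ideal_sub[OF J that] unfolding K_def by (auto simp: P.zero_closed intro!: exI[of _ "\<lambda>_. 0"])
  have clique_K: "mvar v \<in> K" if v: "v \<in> core" for v
  proof -
    have "(\<Sum>c\<in>core. mvar c * (if c = v then 1 else 0)) = (mvar v :: 'k mpoly)"
      using v by (simp add: if_distrib cong: if_cong)
    then show ?thesis unfolding K_def using cR[OF v] P.ideal_zero[OF J]
      by (intro CollectI conjI exI[of _ "\<lambda>c. if c = v then 1 else 0"]) (auto simp: P.zero_closed P.one_closed)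
  qed
  have fR: "f \<in> polys {1..n}" using leaf by (simp add: subst_kernel_def)
  have "f - subst (leaf_subst i) f \<in> K"
  proof (rule diff_subst_mem_ideal[OF K _ fR])
    fix v assume v: "v \<in> {1..n}"
    show "(leaf_subst i v :: 'k mpoly) \<in> polys {1..n} \<and> mvar v - leaf_subst i v \<in> K"
    proof (cases "v \<in> core")
      case True
      then show ?thesis using clique_K by (simp add: leaf_subst_def P.zero_closed)
    next
      case False
      then have s: "v \<in> leaves" using v by auto
      have "mvar (rep i v) \<in> (polys {1..n} :: 'k mpoly set)"
        using rep_bounds[OF s, of i] d_less by (intro mvar_polys) auto
      then show ?thesis using False JK[OF mvar_rep_mem_J[OF i s]] by (auto simp: leaf_subst_def)
    qed
  qed
  then have "f \<in> K" using leaf by (simp add: subst_kernel_def)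
  then obtain g where g: "\<And>c. c \<in> core \<Longrightarrow> g c \<in> polys {1..n}"
    and f: "f - (\<Sum>c\<in>core. mvar c * g c) \<in> J i" unfolding K_def by blast
  have "mvar c * g c \<in> J i" if c: "c \<in> core" for c
  proof -
    let ?\<phi> = "subst (clique_subst i c)"
    have "?\<phi> (f - (\<Sum>c\<in>core. mvar c * g c)) = 0" "?\<phi> f = 0"
      using f J_subset_clique_kernel[OF i c] core[OF c] by (auto simp: subst_kernel_def)
    then have "?\<phi> (\<Sum>c\<in>core. mvar c * g c) = 0" by (simp add: subst_diff)
    \<comment> \<open>Every other clique variable is sent to 0, so only the term of c
      remains.\<close>
    moreover have "?\<phi> (\<Sum>c\<in>core. mvar c * g c) = (\<Sum>v\<in>core. if v = c then mvar c * ?\<phi> (g c) else 0)"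
      unfolding subst_sum subst_mult subst_mvar by (intro sum.cong) (auto simp: clique_subst_def)
    ultimately have "mvar c * ?\<phi> (g c) = 0" using c by simp
    then have "g c \<in> subst_kernel {1..n} (clique_subst i c)"
      using g[OF c] mvar_nonzero by (auto simp: subst_kernel_def)
    then show ?thesis by (rule mvar_mult_clique_kernel[OF i c])
  qed
  then have "(\<Sum>c\<in>core. mvar c * g c) \<in> J i" by (rule P.ideal_sum[OF J])
  then show ?thesis using P.ideal_cong[OF J f] by simp
qed

text \<open>\<open>J i\<close> is the intersection of the kernels, all of them prime, so it suffices
  that l avoids each one.\<close>

lemma nzd_J:
  assumes i: "i \<le> d - e" and l: "l \<in> polys {1..n}"
    and leaf: "subst (leaf_subst i) l \<noteq> 0"
    and core: "\<And>c. c \<in> core \<Longrightarrow> subst (clique_subst i c) l \<noteq> 0"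
  shows "P.nzd {1..n} l (J i :: 'k::field mpoly set)"
  unfolding P.nzd_def
proof (intro ballI impI)
  fix x :: "'k mpoly" assume x: "x \<in> polys {1..n}" "l * x \<in> J i"
  show "x \<in> J i"
  proof (rule kernels_subset_J[OF i])
    show "x \<in> subst_kernel {1..n} (leaf_subst i)"
      using P.nzdD[OF nzd_subst_kernel[OF l leaf] x(1)] J_subset_leaf_kernel[OF i] x(2) by blast
    show "x \<in> subst_kernel {1..n} (clique_subst i c)" if "c \<in> core" for c
      using P.nzdD[OF nzd_subst_kernel[OF l core[OF that]] x(1)] J_subset_clique_kernel[OF i that] x(2)
      by blast
  qed
qed

text \<open>Under \<open>leaf_subst\<close> the two leaves of \<open>\<theta> i\<close> still have
  different representatives. Under \<open>clique_subst\<close> the difference vanishes only if both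
  leaves do, which would need two neighbours of c in one residue class.\<close>

lemma nzd_\<theta>:
  assumes i: "i < d - e"
  shows "P.nzd {1..n} (\<theta> i) (J i :: 'k::field mpoly set)"
proof (rule nzd_J)
  let ?a = "e + i + 1"
  let ?b = "res ?a"
  have a: "?a \<in> leaves" "?b \<in> leaves" using res_bounds[of ?a] e_le i by auto
  have rep: "rep i ?a = ?a" "rep i ?b = ?b" "?a \<noteq> ?b"
    using res_bounds[of ?a] by (auto simp: rep_def res_idem)
  show "subst (leaf_subst i) (\<theta> i) \<noteq> (0 :: 'k mpoly)"
    unfolding subst_\<theta> leaf_subst_def using a rep leaf_not_clique by (auto simp: mvar_eq_iff)
  fix c assume c: "c \<in> core"
  have "\<not> (?a \<in> rep i ` N c \<and> ?b \<in> rep i ` N c)"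
  proof
    assume "?a \<in> rep i ` N c \<and> ?b \<in> rep i ` N c"
    then obtain s t where s: "s \<in> N c" "?a = rep i s" and t: "t \<in> N c" "?b = rep i t" by blast
    \<comment> \<open>The class of the leaf e + i + 1 is still a singleton: merged leaves have
      representatives at most e.\<close>
    have s_eq: "s = ?a"
    proof (rule ccontr)
      assume "s \<noteq> ?a"
      then show False using s(2) res_bounds[of s] by (simp add: rep_def split: if_splits)
    qed
    have t_le: "t \<le> e + i" "res t = ?b"
      using t(2) res_bounds[of ?a] by (auto simp: rep_def split: if_splits)
    then have "(s - 1) mod e = (t - 1) mod e" unfolding s_eq by (simp add: res_def)
    then have "s = t" using N_transversal[OF c s(1) t(1)] by blast
    then show False using s_eq t_le by simp
  qed
  then show "subst (clique_subst i c) (\<theta> i) \<noteq> (0 :: 'k mpoly)"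
    unfolding subst_\<theta> clique_subst_def using a rep leaf_not_clique mvar_nonzero
    by (auto simp: mvar_eq_iff)
qed (use i \<theta>_polys in auto)

text \<open>Once all identifications are made, the clique kernels contain every leaf variable and
  the leaf kernel every clique variable. The summand x_1 survives in the latter case, x_c in the
  former.\<close>

definition \<theta>_last :: "'k::field mpoly" where
  "\<theta>_last = mvar 1 + (\<Sum>c\<in>core. mvar c)"

lemma \<theta>_last_irrelevant: "\<theta>_last \<in> irrelevant_ideal n"
  unfolding \<theta>_last_def irrelevant_ideal_eq_face_ideal using d_less
  by (intro P.ideal_add[OF face_ideal_is_ideal] P.ideal_sum[OF face_ideal_is_ideal])
    (auto simp: mvar_mem_face_ideal_iff)

lemma \<theta>_irrelevant: "i < d - e \<Longrightarrow> \<theta> i \<in> irrelevant_ideal n"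
  unfolding \<theta>_def irrelevant_ideal_eq_face_ideal using res_bounds[of "e + i + 1"] e_le d_less
  by (intro P.ideal_diff[OF face_ideal_is_ideal]) (auto simp: mvar_mem_face_ideal_iff)

lemma nzd_\<theta>_last: "P.nzd {1..n} \<theta>_last (J (d - e) :: 'k::field mpoly set)"
proof (rule nzd_J)
  let ?i = "d - e"
  have one: "(1::nat) \<in> leaves" "rep ?i 1 = 1" using e_pos e_le by (auto simp: rep_def res_self)
  have subst: "subst \<rho> \<theta>_last = \<rho> 1 + (\<Sum>c\<in>core. \<rho> c)" for \<rho> :: "nat \<Rightarrow> 'k mpoly"
    by (simp only: \<theta>_last_def subst_add subst_sum subst_mvar)
  have "(\<Sum>c\<in>core. leaf_subst ?i c) = (0 :: 'k mpoly)" by (intro sum.neutral) (simp add: leaf_subst_def)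
  then show "subst (leaf_subst ?i) \<theta>_last \<noteq> (0 :: 'k mpoly)"
    unfolding subst using one leaf_not_clique mvar_nonzero by (auto simp: leaf_subst_def)
  fix c assume c: "c \<in> core"
  have "(\<Sum>v\<in>core. clique_subst ?i c v) = (\<Sum>v\<in>core. if v = c then mvar c else (0 :: 'k mpoly))"
    by (intro sum.cong) (auto simp: clique_subst_def)
  then have sum: "(\<Sum>v\<in>core. clique_subst ?i c v) = (mvar c :: 'k mpoly)" using c by simp
  \<comment> \<open>The coefficient of x_c decides, whatever becomes of leaf 1: its value is 0 or
    x_1, and x_1 differs from x_c.\<close>
  have "1 \<noteq> c" using one c leaf_not_clique by blast
  then have "Poly_Mapping.single 1 1 \<noteq> (Poly_Mapping.single c 1 :: nat \<Rightarrow>\<^sub>0 nat)"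
    using single_index_eq_iff[of 1 c] by simp
  then have "Poly_Mapping.lookup (subst (clique_subst ?i c) \<theta>_last) (Poly_Mapping.single c 1) = (1 :: 'k)"
    unfolding subst sum using one leaf_not_clique
    by (auto simp: clique_subst_def lookup_add mvar_def lookup_single when_def)
  then show "subst (clique_subst ?i c) \<theta>_last \<noteq> (0 :: 'k mpoly)" by auto
qed (use \<theta>_last_irrelevant P.ideal_sub[OF face_ideal_is_ideal] in
    \<open>auto simp: irrelevant_ideal_eq_face_ideal\<close>)

lemma graph_depth_edges: "graph_depth TYPE('k::field) n edges = enat (d - e + 1)"
proof (rule antisym[OF graph_depth_edges_le])
  let ?fs = "map \<theta> [0..<d - e] @ [\<theta>_last] :: 'k mpoly list"
  have "P.weakly_regular {1..n} (edge_ideal n edges) (map \<theta> [0..<i] :: 'k mpoly list)" if "i \<le> d - e" for i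
    using that
  proof (induction i)
    case (Suc i)
    then show ?case using nzd_\<theta>[of i, where ?'k = 'k] by (simp add: P.weakly_regular_append J_def)
  qed simp
  then have "P.weakly_regular {1..n} (edge_ideal n edges) ?fs"
    using nzd_\<theta>_last[where ?'k = 'k] by (simp add: P.weakly_regular_append J_def)
  moreover have "set ?fs \<subseteq> irrelevant_ideal n" using \<theta>_irrelevant \<theta>_last_irrelevant by auto
  ultimately have "enat (length ?fs) \<le> graph_depth TYPE('k) n edges"
    by (intro graph_depth_ge[OF simple_graph_edges])
  then show "enat (d - e + 1) \<le> graph_depth TYPE('k) n edges" by simp
qed

lemma mem_Graph_dim_depth: "(d, d - e + 1) \<in> Graph_dim_depth TYPE('k::field) n"
  unfolding Graph_dim_depth_def
  using simple_graph_edges connected_graph_edges graph_dim_edges graph_depth_edges by blast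

end

section \<open>Windows that cover the leaves\<close>

lemma window_mod_inj:
  fixes a e s t :: nat
  assumes "s \<in> {a..<a + e}" "t \<in> {a..<a + e}" "s mod e = t mod e"
  shows "s = t"
proof -
  have "s = t" if "s \<le> t" "s \<in> {a..<a + e}" "t \<in> {a..<a + e}" "s mod e = t mod e" for s t
  proof -
    have "e dvd t - s" using that by (metis mod_eq_dvd_iff_nat)
    moreover have "t - s < e" using that by auto
    ultimately have "t - s = 0" by (metis dvd_imp_le not_le zero_less_iff_neq_zero)
    then show ?thesis using that by simp
  qed
  then show ?thesis using assms by (metis nat_le_linear)
qed

lemma C_star_subset: "C_star n \<subseteq> Graph_dim_depth TYPE('k::field) n"
proof
  fix x assume "x \<in> C_star n"
  then obtain d p where x: "x = (d, p)" and p: "1 \<le> p" "p \<le> d" and d: "d \<le> n - 1"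
    and le: "d \<le> (n - d) * (d - p + 1)" by (auto simp: C_star_def)
  define e where "e = d - p + 1"
  \<comment> \<open>The windows tile the leaves in steps of e; the \<open>min\<close> moves those
    that would run past d back onto the last e leaves.\<close>
  define w where "w c = min ((c - d - 1) * e) (d - e)" for c
  have e: "1 \<le> e" "e \<le> d" using p by (auto simp: e_def)
  interpret clique_with_leaves n d e "\<lambda>c. {w c + 1..w c + e}"
  proof
    show "1 \<le> e" "e \<le> d" by (rule e)+
    show "d < n" using p d by linarith
    fix c assume c: "c \<in> {d<..n}"
    have "w c \<le> d - e" by (simp add: w_def)
    then show "{w c + 1..w c + e} \<subseteq> {1..d}" using e by auto
    show "card {w c + 1..w c + e} = e" by simp
    fix s t assume st: "s \<in> {w c + 1..w c + e}" "t \<in> {w c + 1..w c + e}" "(s - 1) mod e = (t - 1) mod e"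
    have "s - 1 \<in> {w c..<w c + e}" "t - 1 \<in> {w c..<w c + e}" using st(1,2) by auto
    then have "s - 1 = t - 1" using st(3) by (rule window_mod_inj)
    then show "s = t" using st(1,2) by auto
  next
    fix s assume s: "s \<in> {1..d}"
    define j where "j = (s - 1) div e"
    \<comment> \<open>The inequality in \<open>C_star\<close> enters here: s lies in one of the
      first n - d blocks of length e.\<close>
    have "s - 1 < (n - d) * e" using s le by (auto simp: e_def)
    then have "j < n - d" unfolding j_def using e by (simp add: less_mult_imp_div_less)
    have j: "j * e \<le> s - 1" "s - 1 < j * e + e"
      unfolding j_def using e mod_less_divisor[of e "s - 1"] div_mult_mod_eq[of "s - 1" e] by linarith+
    have "w (d + j + 1) = min (j * e) (d - e)" by (simp add: w_def)
    then have "s \<in> {w (d + j + 1) + 1..w (d + j + 1) + e}" using j s e by (auto simp: min_def)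
    then show "\<exists>c\<in>{d<..n}. s \<in> {w c + 1..w c + e}" using \<open>j < n - d\<close> by (intro bexI[of _ "d + j + 1"]) auto
  qed
  have "d - e + 1 = p" using p by (simp add: e_def)
  then show "x \<in> Graph_dim_depth TYPE('k) n" using mem_Graph_dim_depth[where ?'k = 'k] x by simp
qed

theorem corollary1p7:
  fixes n :: nat
  assumes "n \<ge> 3"
  shows "Graph_dim_depth TYPE('k::field) n = C_star n"
  using Graph_dim_depth_subset[of n, where ?'k = 'k] C_star_subset[of n, where ?'k = 'k] assms
  by auto

end
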